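(* Let $\mathcal K$ be a plumbus and $(T,i,m)$ an enhanced 2-monad on $\mathcal K$. Then the enhanced 2-category $\mathrm{LaxAlg}(T)$ of lax $T$-algebras and lax $T$-morphisms is a plumbus too, with small discrete opfibrations the strict $T$-morphisms whose underlying map is a small discrete opfibration in $\mathcal K$.
   Context: An enhanced 2-category $\mathcal K$ is a 2-category, whose 1-cells are called loose (written $\rightsquigarrow$), with a wide and locally full sub-2-category whose 1-cells are called tight (written $\to$). It is repletely enhanced if $f$ tight and $f\cong g$ imply $g$ tight. An enhanced 2-functor preserves tight 1-cells; an enhanced 2-monad $(T,i,m)$ is a 2-monad with $T$ preserving tight 1-cells and $i,m$ having tight components. A tight terminal object is a terminal object $1$ all of whose maps $X\to 1$ are tight. A lax $T$-algebra is $(A,\alpha,\upsilon,\mu)$ with $\alpha:TA\to A$ tight, $\upsilon:\mathrm{id}_A\Rightarrow\alpha i_A$ and $\mu:\alpha\circ T\alpha\Rightarrow\alpha\circ m_A$ such that $(\mu\, i_{TA})(\upsilon\alpha)=\mathrm{id}_\alpha$, $(\mu\, Ti_A)(\alpha\, T\upsilon)=\mathrm{id}_\alpha$, $(\mu\, m_{TA})(\mu\, T^2\alpha)=(\mu\, Tm_A)(\alpha\, T\mu)$. A lax $T$-morphism $(f,\bar f):(A,\alpha)\rightsquigarrow(B,\beta)$ is a loose $f$ with $\bar f:\beta\circ Tf\Rightarrow f\circ\alpha$ such that $f\upsilon_A=(\bar f i_A)(\upsilon_B f)$ and $(f\mu_A)(\bar f\,T\alpha)(\beta\,T\bar f)=(\bar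 f m_A)(\mu_B\,T^2f)$; it is pseudo if $\bar f$ is invertible and strict if $\bar f$ is an identity. A $T$-2-morphism $f\Rightarrow f'$ is a 2-cell $\varphi$ with $(\varphi\alpha)\bar f=\bar f'(\beta\,T\varphi)$. $\mathrm{LaxAlg}(T)$ (the paper's $\mathrm{Alg}^{\mathrm{lx}}_{\mathrm{lx},t\mathrm{ps}}(T)$) is the enhanced 2-category of lax $T$-algebras, lax $T$-morphisms as loose 1-cells, pseudo-$T$-morphisms with tight underlying 1-cell as tight 1-cells, and $T$-2-morphisms. A tight discrete opfibration is a tight $p:E\to B$ such that for all $e:X\rightsquigarrow E$, $b:X\rightsquigarrow B$, $\varphi:pe\Rightarrow b$ there is a unique 2-cell $\lambda$ with domain $e$ and $p\lambda=\varphi$. A left-tight pullback of a tight $f:B\to C$ along a loose $g:A\rightsquigarrow C$ is a (strict 2-categorical) pullback whose projection $p_A$ to $A$ is tight and detects tightness: $h$ is tight whenever $p_Ah$ is. A smallness structure on an enhanced 2-category is a class of tight discrete opfibrations, called small, stable under left-tight pullback along arbitrary loose 1-cells, with chosen such pullbacks that are strictly functorial. Equivalently: the codomain 2-functor from the enhanced 2-category of small discrete opfibrations (1-cells: commuting squares with loose sides, tight when both sides are tight; 2-cells: pairs of compatible 2-cells) is a split enhanced discrete 2-fibration, i.e. its underlying functor is a split fibration whose chosen lifts of tights are tight and detect tightness, and it is a discrete opfibration on hom-categories. A plumbus is a repletely enhanced 2-category with a tight terminal object and a smallness structure. *)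

theory Defs
  imports Main
begin

section \<open>Enhanced 2-categories\<close>

text \<open>1-cells and 2-cells carry their boundaries; nothing is assumed about the values of the
  operations outside the carrier sets or on non-composable arguments.\<close>

record ('o, 'a, 'c) two_cat =
  Obj :: "'o set"
  Loose :: "'a set"
  Tight :: "'a set"
  Cells :: "'c set"
  src :: "'a \<Rightarrow> 'o"
  trg :: "'a \<Rightarrow> 'o"
  id1 :: "'o \<Rightarrow> 'a"
  comp1 :: "'a \<Rightarrow> 'a \<Rightarrow> 'a" (infixr "\<cdot>\<index>" 80)
  src2 :: "'c \<Rightarrow> 'a"
  trg2 :: "'c \<Rightarrow> 'a"
  id2 :: "'a \<Rightarrow> 'c"
  vcomp :: "'c \<Rightarrow> 'c \<Rightarrow> 'c" (infixr "\<bullet>\<index>" 70)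
  hcomp :: "'c \<Rightarrow> 'c \<Rightarrow> 'c" (infixr "\<star>\<index>" 75)

abbreviation whisker_left :: "('o, 'a, 'c, 'm) two_cat_scheme \<Rightarrow> 'a \<Rightarrow> 'c \<Rightarrow> 'c"
    (infixr "\<rhd>\<index>" 76)
  where "f \<rhd>\<^bsub>K\<^esub> \<phi> \<equiv> id2 K f \<star>\<^bsub>K\<^esub> \<phi>"

abbreviation whisker_right :: "('o, 'a, 'c, 'm) two_cat_scheme \<Rightarrow> 'c \<Rightarrow> 'a \<Rightarrow> 'c"
    (infixl "\<lhd>\<index>" 77)
  where "\<phi> \<lhd>\<^bsub>K\<^esub> f \<equiv> \<phi> \<star>\<^bsub>K\<^esub> id2 K f"

definition hom1 :: "('o, 'a, 'c, 'm) two_cat_scheme \<Rightarrow> 'o \<Rightarrow> 'o \<Rightarrow> 'a set" where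
  "hom1 K A B = {f \<in> Loose K. src K f = A \<and> trg K f = B}"

definition hom2 :: "('o, 'a, 'c, 'm) two_cat_scheme \<Rightarrow> 'a \<Rightarrow> 'a \<Rightarrow> 'c set" where
  "hom2 K f g = {\<phi> \<in> Cells K. src2 K \<phi> = f \<and> trg2 K \<phi> = g}"

locale two_category =
  fixes K :: "('o, 'a, 'c, 'm) two_cat_scheme" (structure)
  assumes src_obj: "f \<in> Loose K \<Longrightarrow> src K f \<in> Obj K"
    and trg_obj: "f \<in> Loose K \<Longrightarrow> trg K f \<in> Obj K"
    and id1_hom: "A \<in> Obj K \<Longrightarrow> id1 K A \<in> hom1 K A A"
    and comp1_hom: "\<lbrakk>f \<in> hom1 K A B; g \<in> hom1 K B C\<rbrakk> \<Longrightarrow> g \<cdot> f \<in> hom1 K A C"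
    and comp1_id_left: "f \<in> hom1 K A B \<Longrightarrow> id1 K B \<cdot> f = f"
    and comp1_id_right: "f \<in> hom1 K A B \<Longrightarrow> f \<cdot> id1 K A = f"
    and comp1_assoc:
      "\<lbrakk>f \<in> hom1 K A B; g \<in> hom1 K B C; h \<in> hom1 K C D\<rbrakk> \<Longrightarrow> (h \<cdot> g) \<cdot> f = h \<cdot> (g \<cdot> f)"
    and src2_loose: "\<phi> \<in> Cells K \<Longrightarrow> src2 K \<phi> \<in> Loose K"
    and trg2_loose: "\<phi> \<in> Cells K \<Longrightarrow> trg2 K \<phi> \<in> Loose K"
    and cells_src: "\<phi> \<in> Cells K \<Longrightarrow> src K (src2 K \<phi>) = src K (trg2 K \<phi>)"
    and cells_trg: "\<phi> \<in> Cells K \<Longrightarrow> trg K (src2 K \<phi>) = trg K (trg2 K \<phi>)"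
    and id2_hom: "f \<in> Loose K \<Longrightarrow> id2 K f \<in> hom2 K f f"
    and vcomp_hom: "\<lbrakk>\<phi> \<in> hom2 K f g; \<psi> \<in> hom2 K g h\<rbrakk> \<Longrightarrow> \<psi> \<bullet> \<phi> \<in> hom2 K f h"
    and vcomp_id_left: "\<phi> \<in> hom2 K f g \<Longrightarrow> id2 K g \<bullet> \<phi> = \<phi>"
    and vcomp_id_right: "\<phi> \<in> hom2 K f g \<Longrightarrow> \<phi> \<bullet> id2 K f = \<phi>"
    and vcomp_assoc:
      "\<lbrakk>\<phi> \<in> hom2 K f g; \<psi> \<in> hom2 K g h; \<chi> \<in> hom2 K h k\<rbrakk>
        \<Longrightarrow> (\<chi> \<bullet> \<psi>) \<bullet> \<phi> = \<chi> \<bullet> (\<psi> \<bullet> \<phi>)"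
    and hcomp_hom:
      "\<lbrakk>f \<in> hom1 K A B; g \<in> hom1 K B C; \<phi> \<in> hom2 K f f'; \<psi> \<in> hom2 K g g'\<rbrakk>
        \<Longrightarrow> \<psi> \<star> \<phi> \<in> hom2 K (g \<cdot> f) (g' \<cdot> f')"
    and hcomp_id2:
      "\<lbrakk>f \<in> hom1 K A B; g \<in> hom1 K B C\<rbrakk> \<Longrightarrow> id2 K g \<star> id2 K f = id2 K (g \<cdot> f)"
    and interchange:
      "\<lbrakk>f \<in> hom1 K A B; g \<in> hom1 K B C;
        \<phi> \<in> hom2 K f f'; \<phi>' \<in> hom2 K f' f''; \<psi> \<in> hom2 K g g'; \<psi>' \<in> hom2 K g' g''\<rbrakk>
        \<Longrightarrow> (\<psi>' \<bullet> \<psi>) \<star> (\<phi>' \<bullet> \<phi>) = (\<psi>' \<star> \<phi>') \<bullet> (\<psi> \<star> \<phi>)"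
    and hcomp_id_left:
      "\<lbrakk>f \<in> hom1 K A B; \<phi> \<in> hom2 K f f'\<rbrakk> \<Longrightarrow> id1 K B \<rhd> \<phi> = \<phi>"
    and hcomp_id_right:
      "\<lbrakk>f \<in> hom1 K A B; \<phi> \<in> hom2 K f f'\<rbrakk> \<Longrightarrow> \<phi> \<lhd> id1 K A = \<phi>"
    and hcomp_assoc:
      "\<lbrakk>f \<in> hom1 K A B; g \<in> hom1 K B C; h \<in> hom1 K C D;
        \<phi> \<in> hom2 K f f'; \<psi> \<in> hom2 K g g'; \<chi> \<in> hom2 K h h'\<rbrakk>
        \<Longrightarrow> (\<chi> \<star> \<psi>) \<star> \<phi> = \<chi> \<star> (\<psi> \<star> \<phi>)"

locale enhanced_two_category = two_category +
  assumes tight_loose: "Tight K \<subseteq> Loose K"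
    and tight_id1: "A \<in> Obj K \<Longrightarrow> id1 K A \<in> Tight K"
    and tight_comp1: "\<lbrakk>f \<in> Tight K; g \<in> Tight K; trg K f = src K g\<rbrakk> \<Longrightarrow> g \<cdot> f \<in> Tight K"

context
  fixes K :: "('o, 'a, 'c, 'm) two_cat_scheme" (structure)
begin

definition iso2 :: "'c \<Rightarrow> bool" where
  "iso2 \<phi> \<longleftrightarrow> \<phi> \<in> Cells K \<and>
    (\<exists>\<psi> \<in> hom2 K (trg2 K \<phi>) (src2 K \<phi>).
      \<psi> \<bullet> \<phi> = id2 K (src2 K \<phi>) \<and> \<phi> \<bullet> \<psi> = id2 K (trg2 K \<phi>))"

definition isomorphic1 :: "'a \<Rightarrow> 'a \<Rightarrow> bool" where
  "isomorphic1 f g \<longleftrightarrow> (\<exists>\<phi> \<in> hom2 K f g. iso2 \<phi>)"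

text \<open>Terminality is 2-categorical: the hom-category from \<open>X\<close> to \<open>I\<close> is the terminal
  category.\<close>

definition terminal_object :: "'o \<Rightarrow> bool" where
  "terminal_object I \<longleftrightarrow> I \<in> Obj K \<and>
    (\<forall>X \<in> Obj K. (\<exists>!f. f \<in> hom1 K X I) \<and>
      (\<forall>f \<in> hom1 K X I. \<forall>g \<in> hom1 K X I. \<exists>!\<phi>. \<phi> \<in> hom2 K f g))"

definition tight_terminal_object :: "'o \<Rightarrow> bool" where
  "tight_terminal_object I \<longleftrightarrow> terminal_object I \<and>
    (\<forall>X \<in> Obj K. hom1 K X I \<subseteq> Tight K)"

definition tight_discrete_opfibration :: "'a \<Rightarrow> bool" where
  "tight_discrete_opfibration p \<longleftrightarrow> p \<in> Tight K \<and>
    (\<forall>X \<in> Obj K. \<forall>e \<in> hom1 K X (src K p). \<forall>b \<in> hom1 K X (trg K p). \<forall>\<phi> \<in> hom2 K (p \<cdot> e) b.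
      \<exists>!\<chi>. \<chi> \<in> Cells K \<and> src2 K \<chi> = e \<and> p \<rhd> \<chi> = \<phi>)"

text \<open>The square \<open>f \<cdot> q = g \<cdot> p\<close>, with \<open>p\<close> the projection to the source of \<open>g\<close> and \<open>q\<close> the
  projection to the source of \<open>f\<close>, is a strict pullback for 1-cells as well as for 2-cells.\<close>

definition two_pullback :: "'a \<Rightarrow> 'a \<Rightarrow> 'a \<Rightarrow> 'a \<Rightarrow> bool" where
  "two_pullback f g p q \<longleftrightarrow>
    f \<in> Loose K \<and> g \<in> Loose K \<and> trg K f = trg K g \<and>
    p \<in> hom1 K (src K p) (src K g) \<and> q \<in> hom1 K (src K p) (src K f) \<and>
    f \<cdot> q = g \<cdot> p \<and>
    (\<forall>X \<in> Obj K. \<forall>u \<in> hom1 K X (src K g). \<forall>v \<in> hom1 K X (src K f).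
      f \<cdot> v = g \<cdot> u \<longrightarrow> (\<exists>!h. h \<in> hom1 K X (src K p) \<and> p \<cdot> h = u \<and> q \<cdot> h = v)) \<and>
    (\<forall>X \<in> Obj K. \<forall>h \<in> hom1 K X (src K p). \<forall>h' \<in> hom1 K X (src K p).
      \<forall>\<sigma> \<in> hom2 K (p \<cdot> h) (p \<cdot> h'). \<forall>\<tau> \<in> hom2 K (q \<cdot> h) (q \<cdot> h').
        f \<rhd> \<tau> = g \<rhd> \<sigma> \<longrightarrow> (\<exists>!\<chi>. \<chi> \<in> hom2 K h h' \<and> p \<rhd> \<chi> = \<sigma> \<and> q \<rhd> \<chi> = \<tau>))"

definition left_tight_pullback :: "'a \<Rightarrow> 'a \<Rightarrow> 'a \<Rightarrow> 'a \<Rightarrow> bool" where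
  "left_tight_pullback f g p q \<longleftrightarrow> two_pullback f g p q \<and> f \<in> Tight K \<and> p \<in> Tight K \<and>
    (\<forall>X \<in> Obj K. \<forall>h \<in> hom1 K X (src K p). p \<cdot> h \<in> Tight K \<longrightarrow> h \<in> Tight K)"

end

section \<open>Plumbuses\<close>

text \<open>For small \<open>p : E \<rightarrow> B\<close> and loose \<open>g : A \<leadsto> B\<close>, the chosen pullback has projections
  \<open>pr g p\<close> to \<open>A\<close> and \<open>lft g p\<close> to \<open>E\<close>. Stability of the small 1-cells is asked of the chosen
  pullbacks; the class is not required to be closed under isomorphism. The last four assumptions
  express strict functoriality of the choice in \<open>g\<close>.\<close>

locale smallness_structure = enhanced_two_category +
  fixes small :: "'b set"
    and pr :: "'b \<Rightarrow> 'b \<Rightarrow> 'b"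
    and lft :: "'b \<Rightarrow> 'b \<Rightarrow> 'b"
  assumes small_dopf: "p \<in> small \<Longrightarrow> tight_discrete_opfibration K p"
    and pr_small: "\<lbrakk>p \<in> small; g \<in> hom1 K A (trg K p)\<rbrakk> \<Longrightarrow> pr g p \<in> small"
    and chosen_pullback:
      "\<lbrakk>p \<in> small; g \<in> hom1 K A (trg K p)\<rbrakk> \<Longrightarrow> left_tight_pullback K p g (pr g p) (lft g p)"
    and pr_id1: "p \<in> small \<Longrightarrow> pr (id1 K (trg K p)) p = p"
    and lft_id1: "p \<in> small \<Longrightarrow> lft (id1 K (trg K p)) p = id1 K (src K p)"
    and pr_comp1:
      "\<lbrakk>p \<in> small; g \<in> hom1 K A (trg K p); h \<in> hom1 K A' A\<rbrakk>
        \<Longrightarrow> pr (g \<cdot> h) p = pr h (pr g p)"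
    and lft_comp1:
      "\<lbrakk>p \<in> small; g \<in> hom1 K A (trg K p); h \<in> hom1 K A' A\<rbrakk>
        \<Longrightarrow> lft (g \<cdot> h) p = lft g p \<cdot> lft h (pr g p)"

locale plumbus = smallness_structure +
  assumes replete: "\<lbrakk>f \<in> Tight K; g \<in> Loose K; isomorphic1 K f g\<rbrakk> \<Longrightarrow> g \<in> Tight K"
    and tight_terminal: "\<exists>I. tight_terminal_object K I"

section \<open>Enhanced 2-monads\<close>

record ('o, 'a, 'c) two_endo =
  on0 :: "'o \<Rightarrow> 'o"
  on1 :: "'a \<Rightarrow> 'a"
  on2 :: "'c \<Rightarrow> 'c"

record ('o, 'a, 'c) two_monad = "('o, 'a, 'c) two_endo" +
  unit :: "'o \<Rightarrow> 'a"
  mult :: "'o \<Rightarrow> 'a"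

definition id_endo :: "('o, 'a, 'c) two_endo" where
  "id_endo = \<lparr>on0 = \<lambda>A. A, on1 = \<lambda>f. f, on2 = \<lambda>\<phi>. \<phi>\<rparr>"

definition square_endo :: "('o, 'a, 'c, 'n) two_endo_scheme \<Rightarrow> ('o, 'a, 'c) two_endo" where
  "square_endo T =
    \<lparr>on0 = \<lambda>A. on0 T (on0 T A), on1 = \<lambda>f. on1 T (on1 T f), on2 = \<lambda>\<phi>. on2 T (on2 T \<phi>)\<rparr>"

locale enhanced_two_endofunctor = enhanced_two_category +
  fixes T :: "('a, 'b, 'c, 'n) two_endo_scheme"
  assumes on0_obj: "A \<in> Obj K \<Longrightarrow> on0 T A \<in> Obj K"
    and on1_hom: "f \<in> hom1 K A B \<Longrightarrow> on1 T f \<in> hom1 K (on0 T A) (on0 T B)"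
    and on1_tight: "f \<in> Tight K \<Longrightarrow> on1 T f \<in> Tight K"
    and on1_id1: "A \<in> Obj K \<Longrightarrow> on1 T (id1 K A) = id1 K (on0 T A)"
    and on1_comp1: "\<lbrakk>f \<in> hom1 K A B; g \<in> hom1 K B C\<rbrakk> \<Longrightarrow> on1 T (g \<cdot> f) = on1 T g \<cdot> on1 T f"
    and on2_hom: "\<phi> \<in> hom2 K f g \<Longrightarrow> on2 T \<phi> \<in> hom2 K (on1 T f) (on1 T g)"
    and on2_id2: "f \<in> Loose K \<Longrightarrow> on2 T (id2 K f) = id2 K (on1 T f)"
    and on2_vcomp:
      "\<lbrakk>\<phi> \<in> hom2 K f g; \<psi> \<in> hom2 K g h\<rbrakk> \<Longrightarrow> on2 T (\<psi> \<bullet> \<phi>) = on2 T \<psi> \<bullet> on2 T \<phi>"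
    and on2_hcomp:
      "\<lbrakk>f \<in> hom1 K A B; g \<in> hom1 K B C; \<phi> \<in> hom2 K f f'; \<psi> \<in> hom2 K g g'\<rbrakk>
        \<Longrightarrow> on2 T (\<psi> \<star> \<phi>) = on2 T \<psi> \<star> on2 T \<phi>"

text \<open>2-natural with respect to all loose 1-cells, with tight components.\<close>

definition enhanced_two_natural ::
  "('o, 'a, 'c, 'm) two_cat_scheme \<Rightarrow> ('o, 'a, 'c, 'n) two_endo_scheme
    \<Rightarrow> ('o, 'a, 'c, 'l) two_endo_scheme \<Rightarrow> ('o \<Rightarrow> 'a) \<Rightarrow> bool" where
  "enhanced_two_natural K F G \<theta> \<longleftrightarrow>
    (\<forall>A \<in> Obj K. \<theta> A \<in> hom1 K (on0 F A) (on0 G A) \<inter> Tight K) \<and>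
    (\<forall>A \<in> Obj K. \<forall>B \<in> Obj K. \<forall>f \<in> hom1 K A B.
      on1 G f \<cdot>\<^bsub>K\<^esub> \<theta> A = \<theta> B \<cdot>\<^bsub>K\<^esub> on1 F f) \<and>
    (\<forall>A \<in> Obj K. \<forall>B \<in> Obj K. \<forall>f \<in> hom1 K A B. \<forall>g \<in> hom1 K A B. \<forall>\<phi> \<in> hom2 K f g.
      on2 G \<phi> \<lhd>\<^bsub>K\<^esub> \<theta> A = \<theta> B \<rhd>\<^bsub>K\<^esub> on2 F \<phi>)"

locale enhanced_two_monad = enhanced_two_endofunctor K T
  for K :: "('o, 'a, 'c, 'm) two_cat_scheme" (structure)
    and T :: "('o, 'a, 'c, 'n) two_monad_scheme" +
  assumes unit_natural: "enhanced_two_natural K id_endo T (unit T)"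
    and mult_natural: "enhanced_two_natural K (square_endo T) T (mult T)"
    and unit_left: "A \<in> Obj K \<Longrightarrow> mult T A \<cdot> unit T (on0 T A) = id1 K (on0 T A)"
    and unit_right: "A \<in> Obj K \<Longrightarrow> mult T A \<cdot> on1 T (unit T A) = id1 K (on0 T A)"
    and mult_assoc:
      "A \<in> Obj K \<Longrightarrow> mult T A \<cdot> mult T (on0 T A) = mult T A \<cdot> on1 T (mult T A)"

section \<open>Lax algebras\<close>

datatype ('o, 'a, 'c) lax_alg =
  Lax_Alg (carr: 'o) (act: 'a) (lunit: 'c) (lmult: 'c)

datatype ('o, 'a, 'c) lax_mor =
  Lax_Mor (mor_src: "('o, 'a, 'c) lax_alg") (mor_trg: "('o, 'a, 'c) lax_alg")
    (und1: 'a) (mor_cell: 'c)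

datatype ('o, 'a, 'c) alg_cell =
  Alg_Cell (cell_src: "('o, 'a, 'c) lax_mor") (cell_trg: "('o, 'a, 'c) lax_mor") (und2: 'c)

context
  fixes K :: "('o, 'a, 'c, 'm) two_cat_scheme" (structure)
    and T :: "('o, 'a, 'c, 'n) two_monad_scheme"
begin

definition lax_algebra :: "('o, 'a, 'c) lax_alg \<Rightarrow> bool" where
  "lax_algebra X \<longleftrightarrow>
    (let A = carr X; \<alpha> = act X; \<upsilon> = lunit X; \<mu> = lmult X; TA = on0 T A in
      A \<in> Obj K \<and> \<alpha> \<in> hom1 K TA A \<and> \<alpha> \<in> Tight K \<and>
      \<upsilon> \<in> hom2 K (id1 K A) (\<alpha> \<cdot> unit T A) \<and>
      \<mu> \<in> hom2 K (\<alpha> \<cdot> on1 T \<alpha>) (\<alpha> \<cdot> mult T A) \<and>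
      (\<mu> \<lhd> unit T TA) \<bullet> (\<upsilon> \<lhd> \<alpha>) = id2 K \<alpha> \<and>
      (\<mu> \<lhd> on1 T (unit T A)) \<bullet> (\<alpha> \<rhd> on2 T \<upsilon>) = id2 K \<alpha> \<and>
      (\<mu> \<lhd> mult T TA) \<bullet> (\<mu> \<lhd> on1 T (on1 T \<alpha>)) =
        (\<mu> \<lhd> on1 T (mult T A)) \<bullet> (\<alpha> \<rhd> on2 T \<mu>))"

definition lax_morphism :: "('o, 'a, 'c) lax_mor \<Rightarrow> bool" where
  "lax_morphism F \<longleftrightarrow>
    (let X = mor_src F; Y = mor_trg F; f = und1 F; \<phi> = mor_cell F; \<alpha> = act X; \<beta> = act Y in
      lax_algebra X \<and> lax_algebra Y \<and> f \<in> hom1 K (carr X) (carr Y) \<and>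
      \<phi> \<in> hom2 K (\<beta> \<cdot> on1 T f) (f \<cdot> \<alpha>) \<and>
      f \<rhd> lunit X = (\<phi> \<lhd> unit T (carr X)) \<bullet> (lunit Y \<lhd> f) \<and>
      (f \<rhd> lmult X) \<bullet> (\<phi> \<lhd> on1 T \<alpha>) \<bullet> (\<beta> \<rhd> on2 T \<phi>) =
        (\<phi> \<lhd> mult T (carr X)) \<bullet> (lmult Y \<lhd> on1 T (on1 T f)))"

definition pseudo_morphism :: "('o, 'a, 'c) lax_mor \<Rightarrow> bool" where
  "pseudo_morphism F \<longleftrightarrow> lax_morphism F \<and> iso2 K (mor_cell F)"

definition strict_morphism :: "('o, 'a, 'c) lax_mor \<Rightarrow> bool" where
  "strict_morphism F \<longleftrightarrow> lax_morphism F \<and> (\<exists>h \<in> Loose K. mor_cell F = id2 K h)"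

definition algebra_cell :: "('o, 'a, 'c) alg_cell \<Rightarrow> bool" where
  "algebra_cell \<Phi> \<longleftrightarrow>
    (let F = cell_src \<Phi>; G = cell_trg \<Phi>; \<phi> = und2 \<Phi>; X = mor_src F; Y = mor_trg F in
      lax_morphism F \<and> lax_morphism G \<and> mor_src G = X \<and> mor_trg G = Y \<and>
      \<phi> \<in> hom2 K (und1 F) (und1 G) \<and>
      (\<phi> \<lhd> act X) \<bullet> mor_cell F = mor_cell G \<bullet> (act Y \<rhd> on2 T \<phi>))"

definition id_mor :: "('o, 'a, 'c) lax_alg \<Rightarrow> ('o, 'a, 'c) lax_mor" where
  "id_mor X = Lax_Mor X X (id1 K (carr X)) (id2 K (act X))"

definition comp_mor ::
    "('o, 'a, 'c) lax_mor \<Rightarrow> ('o, 'a, 'c) lax_mor \<Rightarrow> ('o, 'a, 'c) lax_mor" where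
  "comp_mor G F = Lax_Mor (mor_src F) (mor_trg G) (und1 G \<cdot> und1 F)
    ((und1 G \<rhd> mor_cell F) \<bullet> (mor_cell G \<lhd> on1 T (und1 F)))"

definition LaxAlg ::
    "(('o, 'a, 'c) lax_alg, ('o, 'a, 'c) lax_mor, ('o, 'a, 'c) alg_cell) two_cat" where
  "LaxAlg = \<lparr>
     Obj = {X. lax_algebra X},
     Loose = {F. lax_morphism F},
     Tight = {F. pseudo_morphism F \<and> und1 F \<in> Tight K},
     Cells = {\<Phi>. algebra_cell \<Phi>},
     src = mor_src,
     trg = mor_trg,
     id1 = id_mor,
     comp1 = comp_mor,
     src2 = cell_src,
     trg2 = cell_trg,
     id2 = (\<lambda>F. Alg_Cell F F (id2 K (und1 F))),
     vcomp = (\<lambda>\<Psi> \<Phi>. Alg_Cell (cell_src \<Phi>) (cell_trg \<Psi>) (und2 \<Psi> \<bullet> und2 \<Phi>)),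
     hcomp = (\<lambda>\<Psi> \<Phi>. Alg_Cell (comp_mor (cell_src \<Psi>) (cell_src \<Phi>))
       (comp_mor (cell_trg \<Psi>) (cell_trg \<Phi>)) (und2 \<Psi> \<star> und2 \<Phi>))\<rparr>"

end

end

theory Submission
  imports Defs
begin

text \<open>The whole argument rests on one feature of a discrete opfibration \<open>p\<close>: a 2-cell into its
  source is determined by its domain together with its image under \<open>p\<close>, and every 2-cell out of
  \<open>p \<cdot> e\<close> has a lift starting at \<open>e\<close>. Hence, over a strict morphism with underlying discrete
  opfibration, an equation of 2-cells holds as soon as the two sides have the same domain and
  the equation holds downstairs. So the axioms of lax algebras, lax morphisms and 2-morphisms are
  reflected by such strict morphisms (\<open>lax_algebra_reflect\<close>, \<open>lax_morphism_reflect\<close>,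
  \<open>algebra_cell_reflect\<close>), and structure is built by lifting structure from the base.

  A lift of the underlying 2-cell and a lift of the comparison 2-cell of its codomain give
  \<open>dopf_LaxAlg\<close>: strict morphisms over discrete opfibrations are discrete opfibrations of
  lax algebras.

  For the pullback of a strict \<open>p : (E, \<epsilon>) \<rightarrow> (B, \<beta>)\<close> along a lax \<open>(g, g') : (A, \<alpha>) \<leadsto> (B, \<beta>)\<close>,
  let \<open>r : Q \<rightarrow> A\<close> and \<open>q : Q \<leadsto> E\<close> be the chosen projections downstairs. The 2-cell
  \<open>g' \<lhd> T r : p \<cdot> \<epsilon> \<cdot> T q \<Rightarrow> g \<cdot> \<alpha> \<cdot> T r\<close> has a lift \<open>\<kappa>\<close> at \<open>\<epsilon> \<cdot> T q\<close>; its codomain and \<open>\<alpha> \<cdot> T r\<close>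
  together determine \<open>\<pi> : T Q \<rightarrow> Q\<close>, for which \<open>r\<close> is strict and \<open>\<kappa> : \<epsilon> \<cdot> T q \<Rightarrow> q \<cdot> \<pi>\<close> has the right
  codomain. The unit and multiplication of \<open>Q\<close> are the lifts of those of \<open>A\<close> along \<open>r\<close>, which is
  itself a discrete opfibration. Their codomains are the required ones because the laws that make
  \<open>q\<close> lax hold already downstairs and so hold upstairs, which also shows that \<open>(q, \<kappa>)\<close> is lax
  (\<open>lax_square_exists\<close>). Every piece of this structure is forced (\<open>lax_square_unique\<close>), so the
  strict functoriality of the choice downstairs is inherited (\<open>lax_square_id\<close>,
  \<open>lax_square_comp\<close>).

  Repleteness holds because an isomorphism of lax morphisms transports invertibility of the
  comparison 2-cell, and the terminal object carries a unique algebra structure.\<close>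

section \<open>Calculation in a strict 2-category\<close>

context two_category
begin

lemma hom1I: "\<lbrakk>f \<in> Loose K; src K f = A; trg K f = B\<rbrakk> \<Longrightarrow> f \<in> hom1 K A B"
  by (simp add: hom1_def)

lemma hom2I: "\<lbrakk>\<phi> \<in> Cells K; src2 K \<phi> = f; trg2 K \<phi> = g\<rbrakk> \<Longrightarrow> \<phi> \<in> hom2 K f g"
  by (simp add: hom2_def)

lemma id1_simps [simp]:
  assumes "A \<in> Obj K"
  shows "id1 K A \<in> Loose K" "src K (id1 K A) = A" "trg K (id1 K A) = A"
  using id1_hom[OF assms] by (auto simp: hom1_def)

lemma comp1_simps [simp]:
  assumes "f \<in> Loose K" "g \<in> Loose K" "src K g = trg K f"
  shows "g \<cdot> f \<in> Loose K" "src K (g \<cdot> f) = src K f" "trg K (g \<cdot> f) = trg K g"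
  using comp1_hom[of f "src K f" "trg K f" g "trg K g"] assms by (auto simp: hom1_def)

lemma comp1_id_simps [simp]:
  shows "\<lbrakk>f \<in> Loose K; trg K f = B\<rbrakk> \<Longrightarrow> id1 K B \<cdot> f = f"
    and "\<lbrakk>f \<in> Loose K; src K f = A\<rbrakk> \<Longrightarrow> f \<cdot> id1 K A = f"
  using comp1_id_left comp1_id_right by (auto simp: hom1_def)

text \<open>The simplification rules of this section state typing by \<open>src\<close>, \<open>trg\<close>, \<open>src2\<close> and \<open>trg2\<close> instead of
  membership in hom-sets, so that every side condition is itself decided by rewriting. Together
  they bring a pasting into a normal form: a right-nested vertical composite of 2-cells
  \<open>f \<rhd> (\<phi> \<lhd> g)\<close>, with right-nested 1-cells \<open>f\<close> and \<open>g\<close>.\<close>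

lemma comp1_assoc_simp [simp]:
  "\<lbrakk>f \<in> Loose K; g \<in> Loose K; h \<in> Loose K; src K g = trg K f; src K h = trg K g\<rbrakk>
    \<Longrightarrow> (h \<cdot> g) \<cdot> f = h \<cdot> (g \<cdot> f)"
  using comp1_assoc by (auto simp: hom1_def)

lemma src_trg_obj [simp]:
  "f \<in> Loose K \<Longrightarrow> src K f \<in> Obj K" "f \<in> Loose K \<Longrightarrow> trg K f \<in> Obj K"
  using src_obj trg_obj by auto

lemma cell_boundary_simps [simp]:
  assumes "\<phi> \<in> Cells K"
  shows "src2 K \<phi> \<in> Loose K" "trg2 K \<phi> \<in> Loose K"
    "src K (trg2 K \<phi>) = src K (src2 K \<phi>)" "trg K (trg2 K \<phi>) = trg K (src2 K \<phi>)"
  using assms src2_loose trg2_loose cells_src cells_trg by auto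

lemma id2_simps [simp]:
  assumes "f \<in> Loose K"
  shows "id2 K f \<in> Cells K" "src2 K (id2 K f) = f" "trg2 K (id2 K f) = f"
  using id2_hom[OF assms] by (auto simp: hom2_def)

lemma vcomp_simps [simp]:
  assumes "\<phi> \<in> Cells K" "\<psi> \<in> Cells K" "src2 K \<psi> = trg2 K \<phi>"
  shows "\<psi> \<bullet> \<phi> \<in> Cells K" "src2 K (\<psi> \<bullet> \<phi>) = src2 K \<phi>" "trg2 K (\<psi> \<bullet> \<phi>) = trg2 K \<psi>"
  using vcomp_hom[of \<phi> "src2 K \<phi>" "trg2 K \<phi>" \<psi> "trg2 K \<psi>"] assms by (auto simp: hom2_def)

lemma vcomp_id_simps [simp]:
  shows "\<lbrakk>\<phi> \<in> Cells K; trg2 K \<phi> = g\<rbrakk> \<Longrightarrow> id2 K g \<bullet> \<phi> = \<phi>"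
    and "\<lbrakk>\<phi> \<in> Cells K; src2 K \<phi> = f\<rbrakk> \<Longrightarrow> \<phi> \<bullet> id2 K f = \<phi>"
  using vcomp_id_left vcomp_id_right by (auto simp: hom2_def)

lemma vcomp_assoc_simp [simp]:
  "\<lbrakk>\<phi> \<in> Cells K; \<psi> \<in> Cells K; \<chi> \<in> Cells K; src2 K \<psi> = trg2 K \<phi>; src2 K \<chi> = trg2 K \<psi>\<rbrakk>
    \<Longrightarrow> (\<chi> \<bullet> \<psi>) \<bullet> \<phi> = \<chi> \<bullet> (\<psi> \<bullet> \<phi>)"
  using vcomp_assoc by (auto simp: hom2_def)

lemma hcomp_simps [simp]:
  assumes "\<phi> \<in> Cells K" "\<psi> \<in> Cells K" "src K (src2 K \<psi>) = trg K (src2 K \<phi>)"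
  shows "\<psi> \<star> \<phi> \<in> Cells K" "src2 K (\<psi> \<star> \<phi>) = src2 K \<psi> \<cdot> src2 K \<phi>"
    "trg2 K (\<psi> \<star> \<phi>) = trg2 K \<psi> \<cdot> trg2 K \<phi>"
proof -
  have "\<psi> \<star> \<phi> \<in> hom2 K (src2 K \<psi> \<cdot> src2 K \<phi>) (trg2 K \<psi> \<cdot> trg2 K \<phi>)"
    by (rule hcomp_hom[OF hom1I hom1I hom2I hom2I]) (use assms in auto)
  then show "\<psi> \<star> \<phi> \<in> Cells K" "src2 K (\<psi> \<star> \<phi>) = src2 K \<psi> \<cdot> src2 K \<phi>"
    "trg2 K (\<psi> \<star> \<phi>) = trg2 K \<psi> \<cdot> trg2 K \<phi>"
    by (auto simp: hom2_def)
qed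

lemma hcomp_id2_simp [simp]:
  "\<lbrakk>f \<in> Loose K; g \<in> Loose K; src K g = trg K f\<rbrakk> \<Longrightarrow> id2 K g \<star> id2 K f = id2 K (g \<cdot> f)"
  using hcomp_id2 by (auto simp: hom1_def)

lemma hcomp_assoc_simp [simp]:
  assumes "\<phi> \<in> Cells K" "\<psi> \<in> Cells K" "\<chi> \<in> Cells K"
    "src K (src2 K \<psi>) = trg K (src2 K \<phi>)" "src K (src2 K \<chi>) = trg K (src2 K \<psi>)"
  shows "(\<chi> \<star> \<psi>) \<star> \<phi> = \<chi> \<star> (\<psi> \<star> \<phi>)"
  by (rule hcomp_assoc[OF hom1I hom1I hom1I hom2I hom2I hom2I]) (use assms in auto)

lemma whisker_left_comp1 [simp]:
  assumes "\<phi> \<in> Cells K" "f \<in> Loose K" "g \<in> Loose K"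
    "src K g = trg K (src2 K \<phi>)" "src K f = trg K g"
  shows "f \<rhd> (g \<rhd> \<phi>) = (f \<cdot> g) \<rhd> \<phi>"
  using hcomp_assoc_simp[of \<phi> "id2 K g" "id2 K f"] assms by simp

lemma whisker_id1 [simp]:
  shows "\<lbrakk>\<phi> \<in> Cells K; trg K (src2 K \<phi>) = B\<rbrakk> \<Longrightarrow> id1 K B \<rhd> \<phi> = \<phi>"
    and "\<lbrakk>\<phi> \<in> Cells K; src K (src2 K \<phi>) = A\<rbrakk> \<Longrightarrow> \<phi> \<lhd> id1 K A = \<phi>"
  using hcomp_id_left[OF hom1I[OF _ refl] hom2I[OF _ refl refl]]
    hcomp_id_right[OF hom1I[OF _ _ refl] hom2I[OF _ refl refl]] by auto

lemma interchange_cells: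
  assumes "\<phi> \<in> Cells K" "\<phi>' \<in> Cells K" "\<psi> \<in> Cells K" "\<psi>' \<in> Cells K"
    "src2 K \<phi>' = trg2 K \<phi>" "src2 K \<psi>' = trg2 K \<psi>" "src K (src2 K \<psi>) = trg K (src2 K \<phi>)"
  shows "(\<psi>' \<bullet> \<psi>) \<star> (\<phi>' \<bullet> \<phi>) = (\<psi>' \<star> \<phi>') \<bullet> (\<psi> \<star> \<phi>)"
  by (rule interchange[OF hom1I hom1I hom2I hom2I hom2I hom2I]) (use assms in auto)

lemma whisker_left_vcomp [simp]:
  assumes "\<phi> \<in> Cells K" "\<psi> \<in> Cells K" "f \<in> Loose K"
    "src2 K \<psi> = trg2 K \<phi>" "src K f = trg K (src2 K \<phi>)"
  shows "f \<rhd> (\<psi> \<bullet> \<phi>) = (f \<rhd> \<psi>) \<bullet> (f \<rhd> \<phi>)"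
  using interchange_cells[of \<phi> \<psi> "id2 K f" "id2 K f"] assms by simp

lemma whisker_right_vcomp [simp]:
  assumes "\<phi> \<in> Cells K" "\<psi> \<in> Cells K" "f \<in> Loose K"
    "src2 K \<psi> = trg2 K \<phi>" "trg K f = src K (src2 K \<phi>)"
  shows "(\<psi> \<bullet> \<phi>) \<lhd> f = (\<psi> \<lhd> f) \<bullet> (\<phi> \<lhd> f)"
  using interchange_cells[of "id2 K f" "id2 K f" \<phi> \<psi>] assms by simp

text \<open>Horizontal composites of two proper 2-cells stay outside this normal form; the next two lemmas
  resolve them, and their combination is the middle-four exchange that moves two whiskered 2-cells
  past each other.\<close>

lemma hcomp_right_first:
  assumes "\<phi> \<in> Cells K" "\<psi> \<in> Cells K" "src K (src2 K \<psi>) = trg K (src2 K \<phi>)"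
  shows "\<psi> \<star> \<phi> = (\<psi> \<lhd> trg2 K \<phi>) \<bullet> (src2 K \<psi> \<rhd> \<phi>)"
  using interchange_cells[of \<phi> "id2 K (trg2 K \<phi>)" "id2 K (src2 K \<psi>)" \<psi>] assms by simp

lemma hcomp_left_first:
  assumes "\<phi> \<in> Cells K" "\<psi> \<in> Cells K" "src K (src2 K \<psi>) = trg K (src2 K \<phi>)"
  shows "\<psi> \<star> \<phi> = (trg2 K \<psi> \<rhd> \<phi>) \<bullet> (\<psi> \<lhd> src2 K \<phi>)"
  using interchange_cells[of "id2 K (src2 K \<phi>)" \<phi> \<psi> "id2 K (trg2 K \<psi>)"] assms by simp

text \<open>Rewrites an initial segment of a right-nested vertical composite; the segment and its
  replacement may have different intermediate 1-cells.\<close>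

lemma vcomp_cong_2:
  assumes "\<psi> \<bullet> \<phi> = \<psi>' \<bullet> \<phi>'" "\<phi> \<in> Cells K" "\<psi> \<in> Cells K" "src2 K \<psi> = trg2 K \<phi>"
    "\<phi>' \<in> Cells K" "\<psi>' \<in> Cells K" "src2 K \<psi>' = trg2 K \<phi>'"
    "\<chi> \<in> Cells K" "src2 K \<phi> = trg2 K \<chi>"
  shows "\<psi> \<bullet> (\<phi> \<bullet> \<chi>) = \<psi>' \<bullet> (\<phi>' \<bullet> \<chi>)"
proof -
  have "src2 K \<phi>' = trg2 K \<chi>" using assms by (metis vcomp_simps(2))
  then show ?thesis
    using assms vcomp_assoc_simp[of \<chi> \<phi> \<psi>] vcomp_assoc_simp[of \<chi> \<phi>' \<psi>'] by simp
qed

lemma iso2_iff: "iso2 K \<phi> \<longleftrightarrow> \<phi> \<in> Cells K \<and> (\<exists>\<psi> \<in> Cells K. src2 K \<psi> = trg2 K \<phi> \<and>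
   trg2 K \<psi> = src2 K \<phi> \<and> \<psi> \<bullet> \<phi> = id2 K (src2 K \<phi>) \<and> \<phi> \<bullet> \<psi> = id2 K (trg2 K \<phi>))"
  by (auto simp: iso2_def hom2_def)

lemma iso2_id2: "f \<in> Loose K \<Longrightarrow> iso2 K (id2 K f)"
  by (auto simp: iso2_iff intro!: bexI[of _ "id2 K f"])

lemma iso2_vcomp:
  assumes "iso2 K \<phi>" "iso2 K \<psi>" "src2 K \<psi> = trg2 K \<phi>"
  shows "iso2 K (\<psi> \<bullet> \<phi>)"
proof -
  obtain \<phi>' where a: "\<phi> \<in> Cells K" "\<phi>' \<in> Cells K" "src2 K \<phi>' = trg2 K \<phi>" "trg2 K \<phi>' = src2 K \<phi>"
    "\<phi>' \<bullet> \<phi> = id2 K (src2 K \<phi>)" "\<phi> \<bullet> \<phi>' = id2 K (trg2 K \<phi>)"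
    using assms(1) by (auto simp: iso2_iff)
  obtain \<psi>' where b: "\<psi> \<in> Cells K" "\<psi>' \<in> Cells K" "src2 K \<psi>' = trg2 K \<psi>" "trg2 K \<psi>' = src2 K \<psi>"
    "\<psi>' \<bullet> \<psi> = id2 K (src2 K \<psi>)" "\<psi> \<bullet> \<psi>' = id2 K (trg2 K \<psi>)"
    using assms(2) by (auto simp: iso2_iff)
  have 1: "\<psi>' \<bullet> (\<psi> \<bullet> \<phi>) = \<phi>" "\<phi> \<bullet> (\<phi>' \<bullet> \<psi>') = \<psi>'"
    using a b assms(3) vcomp_assoc_simp[of \<phi> \<psi> \<psi>'] vcomp_assoc_simp[of \<psi>' \<phi>' \<phi>] by simp_all
  show ?thesis
    unfolding iso2_iff
    by (intro conjI bexI[of _ "\<phi>' \<bullet> \<psi>'"]) (use a b assms(3) 1 in simp_all)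
qed

lemma iso2_whisker_left:
  assumes "iso2 K \<phi>" "f \<in> Loose K" "src K f = trg K (src2 K \<phi>)"
  shows "iso2 K (f \<rhd> \<phi>)"
proof -
  obtain \<phi>' where a: "\<phi> \<in> Cells K" "\<phi>' \<in> Cells K" "src2 K \<phi>' = trg2 K \<phi>" "trg2 K \<phi>' = src2 K \<phi>"
    "\<phi>' \<bullet> \<phi> = id2 K (src2 K \<phi>)" "\<phi> \<bullet> \<phi>' = id2 K (trg2 K \<phi>)"
    using assms(1) by (auto simp: iso2_iff)
  show ?thesis
    unfolding iso2_iff
    by (intro conjI bexI[of _ "f \<rhd> \<phi>'"])
      (use a assms whisker_left_vcomp[of \<phi> \<phi>' f] whisker_left_vcomp[of \<phi>' \<phi> f]
        in \<open>simp_all del: whisker_left_vcomp\<close>)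
qed

lemma iso2_whisker_right:
  assumes "iso2 K \<phi>" "f \<in> Loose K" "trg K f = src K (src2 K \<phi>)"
  shows "iso2 K (\<phi> \<lhd> f)"
proof -
  obtain \<phi>' where a: "\<phi> \<in> Cells K" "\<phi>' \<in> Cells K" "src2 K \<phi>' = trg2 K \<phi>" "trg2 K \<phi>' = src2 K \<phi>"
    "\<phi>' \<bullet> \<phi> = id2 K (src2 K \<phi>)" "\<phi> \<bullet> \<phi>' = id2 K (trg2 K \<phi>)"
    using assms(1) by (auto simp: iso2_iff)
  show ?thesis
    unfolding iso2_iff
    by (intro conjI bexI[of _ "\<phi>' \<lhd> f"])
      (use a assms whisker_right_vcomp[of \<phi> \<phi>' f] whisker_right_vcomp[of \<phi>' \<phi> f]
        in \<open>simp_all del: whisker_right_vcomp\<close>)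
qed

text \<open>The codomain of the lift is part of its data: all that is known in advance is that \<open>p\<close> sends it to
  the codomain of \<open>\<phi>\<close>.\<close>

lemma dopf_lift:
  assumes "tight_discrete_opfibration K p" "e \<in> Loose K" "trg K e = src K p" "p \<in> Loose K"
    "\<phi> \<in> Cells K" "src2 K \<phi> = p \<cdot> e"
  obtains \<chi> where "\<chi> \<in> Cells K" "src2 K \<chi> = e" "p \<rhd> \<chi> = \<phi>" "p \<cdot> trg2 K \<chi> = trg2 K \<phi>"
proof -
  have "e \<in> hom1 K (src K e) (src K p)" "trg2 K \<phi> \<in> hom1 K (src K e) (trg K p)"
    "\<phi> \<in> hom2 K (p \<cdot> e) (trg2 K \<phi>)" "src K e \<in> Obj K"
    using assms(2-6) by (simp_all add: hom1_def hom2_def)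
  then obtain \<chi> where c: "\<chi> \<in> Cells K" "src2 K \<chi> = e" "p \<rhd> \<chi> = \<phi>"
    using assms(1) unfolding tight_discrete_opfibration_def by blast
  moreover have "p \<cdot> trg2 K \<chi> = trg2 K \<phi>"
    using hcomp_simps(3)[of \<chi> "id2 K p"] c assms(3,4) by simp
  ultimately show thesis by (rule that)
qed

text \<open>The two lifts may a priori have different codomains, and the conclusion identifies these as well:
  most codomains below are computed in this way.\<close>

lemma dopf_unique:
  assumes "tight_discrete_opfibration K p" "p \<in> Loose K" "\<chi> \<in> Cells K" "\<chi>' \<in> Cells K"
    "src2 K \<chi> = src2 K \<chi>'" "trg K (src2 K \<chi>') = src K p" "p \<rhd> \<chi> = p \<rhd> \<chi>'"
  shows "\<chi> = \<chi>'"
proof -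
  let ?e = "src2 K \<chi>" and ?b = "p \<cdot> trg2 K \<chi>"
  have "?e \<in> hom1 K (src K ?e) (src K p)" "?b \<in> hom1 K (src K ?e) (trg K p)"
    "src K ?e \<in> Obj K"
    using assms(2-6) by (simp_all add: hom1_def)
  moreover have "p \<rhd> \<chi> \<in> hom2 K (p \<cdot> ?e) ?b"
    by (rule hom2I) (use assms(2-6) in simp_all)
  ultimately have "\<exists>!\<zeta>. \<zeta> \<in> Cells K \<and> src2 K \<zeta> = ?e \<and> p \<rhd> \<zeta> = p \<rhd> \<chi>"
    using assms(1) unfolding tight_discrete_opfibration_def by blast
  moreover have "src2 K \<chi>' = ?e" "p \<rhd> \<chi>' = p \<rhd> \<chi>"
    using assms by simp_all
  ultimately show ?thesis using assms(3,4) by blast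
qed

text \<open>The inverse is the lift of the inverse downstairs. That it has the right codomain follows from
  its composite with \<open>\<chi>\<close> being a lift of an identity.\<close>

lemma dopf_reflects_iso:
  assumes p: "tight_discrete_opfibration K p" "p \<in> Loose K"
    and c: "\<chi> \<in> Cells K" "trg K (src2 K \<chi>) = src K p" and i: "iso2 K (p \<rhd> \<chi>)"
  shows "iso2 K \<chi>"
proof -
  obtain \<psi> where s: "\<psi> \<in> Cells K" "src2 K \<psi> = p \<cdot> trg2 K \<chi>" "trg2 K \<psi> = p \<cdot> src2 K \<chi>"
    "\<psi> \<bullet> (p \<rhd> \<chi>) = id2 K (p \<cdot> src2 K \<chi>)" "(p \<rhd> \<chi>) \<bullet> \<psi> = id2 K (p \<cdot> trg2 K \<chi>)"
    using i p c by (auto simp: iso2_iff)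
  obtain \<chi>' where d: "\<chi>' \<in> Cells K" "src2 K \<chi>' = trg2 K \<chi>" "p \<rhd> \<chi>' = \<psi>"
    using dopf_lift[OF p(1) _ _ p(2) s(1,2)] c by auto
  have "\<chi>' \<bullet> \<chi> = id2 K (src2 K \<chi>)"
    by (rule dopf_unique[OF p]) (use c p d s in simp_all)
  moreover have "trg2 K \<chi>' = src2 K \<chi>"
    using arg_cong[OF calculation, of "trg2 K"] vcomp_simps(3)[OF c(1) d(1,2)]
      id2_simps(3)[of "src2 K \<chi>"] c(1) by (metis src2_loose)
  moreover have "\<chi> \<bullet> \<chi>' = id2 K (trg2 K \<chi>)"
    by (rule dopf_unique[OF p]) (use c p d s calculation(2) in simp_all)
  ultimately show ?thesis unfolding iso2_iff using c d by blast
qed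

lemma terminal_eq1:
  assumes "terminal_object K I" "f \<in> Loose K" "g \<in> Loose K" "src K f = src K g"
    "trg K f = I" "trg K g = I"
  shows "f = g"
proof -
  have "\<exists>!h. h \<in> hom1 K (src K g) I"
    using assms(1,3) unfolding terminal_object_def by auto
  moreover have "f \<in> hom1 K (src K g) I" "g \<in> hom1 K (src K g) I"
    using assms by (auto simp: hom1_def)
  ultimately show ?thesis by blast
qed

lemma terminal_ex1:
  assumes "terminal_object K I" "X \<in> Obj K"
  obtains f where "f \<in> Loose K" "src K f = X" "trg K f = I"
  using assms unfolding terminal_object_def hom1_def by blast

lemma terminal_ex2:
  assumes "terminal_object K I" "f \<in> Loose K" "g \<in> Loose K" "src K f = src K g"
    "trg K f = I" "trg K g = I"
  obtains \<phi> where "\<phi> \<in> Cells K" "src2 K \<phi> = f" "trg2 K \<phi> = g"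
proof -
  have "f \<in> hom1 K (src K f) I" "g \<in> hom1 K (src K f) I" "src K f \<in> Obj K"
    using assms by (simp_all add: hom1_def)
  then have "\<exists>!\<phi>. \<phi> \<in> hom2 K f g"
    using assms(1) unfolding terminal_object_def by blast
  then show thesis using that by (auto simp: hom2_def)
qed

lemma terminal_eq2:
  assumes I: "terminal_object K I" and "\<phi> \<in> Cells K" "\<psi> \<in> Cells K"
    "src2 K \<phi> = src2 K \<psi>" "trg K (src2 K \<psi>) = I"
  shows "\<phi> = \<psi>"
proof -
  have t: "trg2 K \<phi> = trg2 K \<psi>"
    by (rule terminal_eq1[OF I]) (use assms in simp_all)
  have h: "src2 K \<psi> \<in> hom1 K (src K (src2 K \<psi>)) I" "trg2 K \<psi> \<in> hom1 K (src K (src2 K \<psi>)) I"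
    "src K (src2 K \<psi>) \<in> Obj K"
    using assms(3,5) by (simp_all add: hom1_def)
  have "\<exists>!\<chi>. \<chi> \<in> hom2 K (src2 K \<psi>) (trg2 K \<psi>)"
    using I h unfolding terminal_object_def by blast
  moreover have "\<phi> \<in> hom2 K (src2 K \<psi>) (trg2 K \<psi>)" "\<psi> \<in> hom2 K (src2 K \<psi>) (trg2 K \<psi>)"
    using assms t by (simp_all add: hom2_def)
  ultimately show ?thesis by blast
qed

lemma terminal_iso2:
  assumes I: "terminal_object K I" and "\<phi> \<in> Cells K" "trg K (src2 K \<phi>) = I"
  shows "iso2 K \<phi>"
proof -
  obtain \<psi> where p: "\<psi> \<in> Cells K" "src2 K \<psi> = trg2 K \<phi>" "trg2 K \<psi> = src2 K \<phi>"
    by (rule terminal_ex2[OF I, of "trg2 K \<phi>" "src2 K \<phi>"]) (use assms in simp_all)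
  have "\<psi> \<bullet> \<phi> = id2 K (src2 K \<phi>)" "\<phi> \<bullet> \<psi> = id2 K (trg2 K \<phi>)"
    by (rule terminal_eq2[OF I]; use assms p in simp)+
  then show ?thesis using assms p unfolding iso2_iff by blast
qed

lemma iso2_inverse:
  assumes "iso2 K \<phi>"
  obtains \<psi> where "\<phi> \<in> Cells K" "\<psi> \<in> Cells K" "src2 K \<psi> = trg2 K \<phi>" "trg2 K \<psi> = src2 K \<phi>"
    "\<psi> \<bullet> \<phi> = id2 K (src2 K \<phi>)" "\<phi> \<bullet> \<psi> = id2 K (trg2 K \<phi>)"
  using assms by (auto simp: iso2_iff)

lemma two_pullback_simps:
  assumes "two_pullback K f g p q"
  shows "f \<in> Loose K" "g \<in> Loose K" "trg K f = trg K g" "p \<in> Loose K" "trg K p = src K g"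
    "q \<in> Loose K" "src K q = src K p" "trg K q = src K f" "f \<cdot> q = g \<cdot> p"
  using assms unfolding two_pullback_def hom1_def by auto

lemma two_pullback_ex1:
  assumes "two_pullback K f g p q" "u \<in> Loose K" "v \<in> Loose K" "src K u = src K v"
    "trg K u = src K g" "trg K v = src K f" "f \<cdot> v = g \<cdot> u"
  obtains h where "h \<in> Loose K" "src K h = src K u" "trg K h = src K p" "p \<cdot> h = u" "q \<cdot> h = v"
proof -
  have "u \<in> hom1 K (src K u) (src K g)" "v \<in> hom1 K (src K u) (src K f)" "src K u \<in> Obj K"
    using assms(2-6) by (simp_all add: hom1_def)
  then have "\<exists>!h. h \<in> hom1 K (src K u) (src K p) \<and> p \<cdot> h = u \<and> q \<cdot> h = v"
    using assms(1,7) unfolding two_pullback_def by blast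
  then show thesis using that unfolding hom1_def by blast
qed

lemma two_pullback_eq1:
  assumes "two_pullback K f g p q" "h \<in> Loose K" "h' \<in> Loose K" "src K h = src K h'"
    "trg K h = src K p" "trg K h' = src K p" "p \<cdot> h = p \<cdot> h'" "q \<cdot> h = q \<cdot> h'"
  shows "h = h'"
proof -
  note pb = two_pullback_simps[OF assms(1)]
  have "p \<cdot> h' \<in> hom1 K (src K h') (src K g)" "q \<cdot> h' \<in> hom1 K (src K h') (src K f)" "src K h' \<in> Obj K"
    using assms(2-6) pb(1-8) by (simp_all add: hom1_def)
  moreover have "f \<cdot> (q \<cdot> h') = g \<cdot> (p \<cdot> h')"
    using arg_cong[OF pb(9), of "\<lambda>k. k \<cdot> h'"] assms(2-6) pb(1-8) by simp
  ultimately have "\<exists>!k. k \<in> hom1 K (src K h') (src K p) \<and> p \<cdot> k = p \<cdot> h' \<and> q \<cdot> k = q \<cdot> h'"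
    using assms(1) unfolding two_pullback_def by blast
  moreover have "h \<in> hom1 K (src K h') (src K p)" "h' \<in> hom1 K (src K h') (src K p)"
    using assms(2-6) by (simp_all add: hom1_def)
  ultimately show ?thesis using assms(7,8) by blast
qed

lemma two_pullback_ex2:
  assumes "two_pullback K f g p q" "h \<in> Loose K" "h' \<in> Loose K" "src K h = src K h'"
    "trg K h = src K p" "trg K h' = src K p"
    "\<sigma> \<in> Cells K" "src2 K \<sigma> = p \<cdot> h" "trg2 K \<sigma> = p \<cdot> h'"
    "\<tau> \<in> Cells K" "src2 K \<tau> = q \<cdot> h" "trg2 K \<tau> = q \<cdot> h'"
    "f \<rhd> \<tau> = g \<rhd> \<sigma>"
  obtains \<chi> where "\<chi> \<in> Cells K" "src2 K \<chi> = h" "trg2 K \<chi> = h'" "p \<rhd> \<chi> = \<sigma>" "q \<rhd> \<chi> = \<tau>"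
proof -
  have "h \<in> hom1 K (src K h) (src K p)" "h' \<in> hom1 K (src K h) (src K p)" "src K h \<in> Obj K"
    "\<sigma> \<in> hom2 K (p \<cdot> h) (p \<cdot> h')" "\<tau> \<in> hom2 K (q \<cdot> h) (q \<cdot> h')"
    using assms(2-12) by (simp_all add: hom1_def hom2_def)
  then have "\<exists>!\<chi>. \<chi> \<in> hom2 K h h' \<and> p \<rhd> \<chi> = \<sigma> \<and> q \<rhd> \<chi> = \<tau>"
    using assms(1,13) unfolding two_pullback_def by blast
  then show thesis using that unfolding hom2_def by blast
qed

lemma comp1_square_assoc:
  assumes "f \<cdot> q = g \<cdot> p" "f \<in> Loose K" "g \<in> Loose K" "p \<in> Loose K" "q \<in> Loose K"
    "src K f = trg K q" "src K g = trg K p" "x \<in> Loose K" "trg K x = src K q" "trg K x = src K p"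
  shows "f \<cdot> (q \<cdot> x) = g \<cdot> (p \<cdot> x)"
  using comp1_assoc_simp[of x q f] comp1_assoc_simp[of x p g] assms by (simp del: comp1_assoc_simp)

end

section \<open>The 2-monad\<close>

context enhanced_two_monad
begin

lemma on0_simps [simp]: "A \<in> Obj K \<Longrightarrow> on0 T A \<in> Obj K"
  by (rule on0_obj)

lemma on1_simps [simp]:
  assumes "f \<in> Loose K"
  shows "on1 T f \<in> Loose K" "src K (on1 T f) = on0 T (src K f)" "trg K (on1 T f) = on0 T (trg K f)"
  using on1_hom[OF hom1I[OF assms refl refl]] by (auto simp: hom1_def)

lemma on2_simps [simp]:
  assumes "\<phi> \<in> Cells K"
  shows "on2 T \<phi> \<in> Cells K" "src2 K (on2 T \<phi>) = on1 T (src2 K \<phi>)"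
    "trg2 K (on2 T \<phi>) = on1 T (trg2 K \<phi>)"
  using on2_hom[OF hom2I[OF assms refl refl]] by (auto simp: hom2_def)

lemma on1_functor [simp]:
  shows "A \<in> Obj K \<Longrightarrow> on1 T (id1 K A) = id1 K (on0 T A)"
    and "\<lbrakk>f \<in> Loose K; g \<in> Loose K; src K g = trg K f\<rbrakk> \<Longrightarrow> on1 T (g \<cdot> f) = on1 T g \<cdot> on1 T f"
  using on1_id1 on1_comp1[OF hom1I hom1I] by auto

lemma on2_functor [simp]:
  shows "f \<in> Loose K \<Longrightarrow> on2 T (id2 K f) = id2 K (on1 T f)"
    and "\<lbrakk>\<phi> \<in> Cells K; \<psi> \<in> Cells K; src2 K \<psi> = trg2 K \<phi>\<rbrakk>
      \<Longrightarrow> on2 T (\<psi> \<bullet> \<phi>) = on2 T \<psi> \<bullet> on2 T \<phi>"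
    and "\<lbrakk>\<phi> \<in> Cells K; \<psi> \<in> Cells K; src K (src2 K \<psi>) = trg K (src2 K \<phi>)\<rbrakk>
      \<Longrightarrow> on2 T (\<psi> \<star> \<phi>) = on2 T \<psi> \<star> on2 T \<phi>"
  using on2_id2 on2_vcomp[OF hom2I hom2I]
    on2_hcomp[OF hom1I[OF _ refl refl] hom1I[OF _ _ refl] hom2I[OF _ refl refl] hom2I[OF _ refl refl]]
  by auto

lemma unit_simps [simp]:
  assumes "A \<in> Obj K"
  shows "unit T A \<in> Loose K" "src K (unit T A) = A" "trg K (unit T A) = on0 T A"
  using unit_natural assms by (auto simp: enhanced_two_natural_def id_endo_def hom1_def)

lemma mult_simps [simp]:
  assumes "A \<in> Obj K"
  shows "mult T A \<in> Loose K"
    "src K (mult T A) = on0 T (on0 T A)" "trg K (mult T A) = on0 T A"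
  using mult_natural assms by (auto simp: enhanced_two_natural_def square_endo_def hom1_def)

text \<open>Naturality is oriented so that the unit and multiplication move to the left through 1-cells in the
  image of \<open>T\<close>. This gives the boundaries of the 2-cells in the algebra axioms a common normal form.\<close>

lemma unit_nat1 [simp]:
  assumes "f \<in> Loose K" "src K f = A"
  shows "on1 T f \<cdot> unit T A = unit T (trg K f) \<cdot> f"
  using unit_natural assms by (auto simp: enhanced_two_natural_def id_endo_def hom1_def)

lemma mult_nat1 [simp]:
  assumes "f \<in> Loose K" "src K f = A"
  shows "on1 T f \<cdot> mult T A = mult T (trg K f) \<cdot> on1 T (on1 T f)"
  using mult_natural assms by (auto simp: enhanced_two_natural_def square_endo_def hom1_def)

lemma nat1_assoc [simp]:
  assumes "f \<in> Loose K" "src K f = A" "x \<in> Loose K"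
  shows "trg K x = A \<Longrightarrow> on1 T f \<cdot> (unit T A \<cdot> x) = unit T (trg K f) \<cdot> (f \<cdot> x)"
    and "trg K x = on0 T (on0 T A) \<Longrightarrow>
      on1 T f \<cdot> (mult T A \<cdot> x) = mult T (trg K f) \<cdot> (on1 T (on1 T f) \<cdot> x)"
proof -
  have A: "A \<in> Obj K" using assms(1,2) by auto
  show "on1 T f \<cdot> (unit T A \<cdot> x) = unit T (trg K f) \<cdot> (f \<cdot> x)" if "trg K x = A"
    using arg_cong[OF unit_nat1[OF assms(1,2)], of "\<lambda>g. g \<cdot> x"] assms that A
    by (simp del: unit_nat1)
  show "on1 T f \<cdot> (mult T A \<cdot> x) = mult T (trg K f) \<cdot> (on1 T (on1 T f) \<cdot> x)"
    if "trg K x = on0 T (on0 T A)"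
    using arg_cong[OF mult_nat1[OF assms(1,2)], of "\<lambda>g. g \<cdot> x"] assms that A
    by (simp del: mult_nat1)
qed

lemma on1_square:
  assumes "f \<cdot> q = g \<cdot> p" "f \<in> Loose K" "g \<in> Loose K" "p \<in> Loose K" "q \<in> Loose K"
    "src K f = trg K q" "src K g = trg K p"
  shows "on1 T f \<cdot> on1 T q = on1 T g \<cdot> on1 T p"
  using arg_cong[OF assms(1), of "on1 T"] assms(2-) by simp

section \<open>The 2-category of lax algebras\<close>

text \<open>The typing of the data is separated from the axioms: the former are safe rewrite rules, whereas the
  latter are applied by hand in whiskered form.\<close>

lemma lax_algebra_simps [simp]:
  assumes "lax_algebra K T X"
  shows "carr X \<in> Obj K" "act X \<in> Loose K" "act X \<in> Tight K"
    "src K (act X) = on0 T (carr X)" "trg K (act X) = carr X"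
    "lunit X \<in> Cells K" "src2 K (lunit X) = id1 K (carr X)"
    "trg2 K (lunit X) = act X \<cdot> unit T (carr X)"
    "lmult X \<in> Cells K" "src2 K (lmult X) = act X \<cdot> on1 T (act X)"
    "trg2 K (lmult X) = act X \<cdot> mult T (carr X)"
  using assms by (auto simp: lax_algebra_def Let_def hom1_def hom2_def)

lemma lax_algebra_laws:
  assumes "lax_algebra K T X"
  shows "(lmult X \<lhd> unit T (on0 T (carr X))) \<bullet> (lunit X \<lhd> act X) = id2 K (act X)"
    "(lmult X \<lhd> on1 T (unit T (carr X))) \<bullet> (act X \<rhd> on2 T (lunit X)) = id2 K (act X)"
    "(lmult X \<lhd> mult T (on0 T (carr X))) \<bullet> (lmult X \<lhd> on1 T (on1 T (act X))) =
      (lmult X \<lhd> on1 T (mult T (carr X))) \<bullet> (act X \<rhd> on2 T (lmult X))"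
  using assms unfolding lax_algebra_def Let_def by blast+

lemma lax_morphism_simps [simp]:
  assumes "lax_morphism K T F"
  shows "lax_algebra K T (mor_src F)" "lax_algebra K T (mor_trg F)" "und1 F \<in> Loose K"
    "src K (und1 F) = carr (mor_src F)" "trg K (und1 F) = carr (mor_trg F)"
    "mor_cell F \<in> Cells K" "src2 K (mor_cell F) = act (mor_trg F) \<cdot> on1 T (und1 F)"
    "trg2 K (mor_cell F) = und1 F \<cdot> act (mor_src F)"
  using assms by (auto simp: lax_morphism_def Let_def hom1_def hom2_def)

lemma lax_morphism_laws:
  assumes "lax_morphism K T F"
  shows "und1 F \<rhd> lunit (mor_src F) =
      (mor_cell F \<lhd> unit T (carr (mor_src F))) \<bullet> (lunit (mor_trg F) \<lhd> und1 F)"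
    "(und1 F \<rhd> lmult (mor_src F)) \<bullet> (mor_cell F \<lhd> on1 T (act (mor_src F)))
        \<bullet> (act (mor_trg F) \<rhd> on2 T (mor_cell F)) =
      (mor_cell F \<lhd> mult T (carr (mor_src F))) \<bullet> (lmult (mor_trg F) \<lhd> on1 T (on1 T (und1 F)))"
  using assms unfolding lax_morphism_def Let_def by blast+

lemma lax_morphismI:
  assumes "lax_algebra K T X" "lax_algebra K T Y" "f \<in> Loose K"
    "src K f = carr X" "trg K f = carr Y"
    "\<phi> \<in> Cells K" "src2 K \<phi> = act Y \<cdot> on1 T f" "trg2 K \<phi> = f \<cdot> act X"
    "f \<rhd> lunit X = (\<phi> \<lhd> unit T (carr X)) \<bullet> (lunit Y \<lhd> f)"
    "(f \<rhd> lmult X) \<bullet> (\<phi> \<lhd> on1 T (act X)) \<bullet> (act Y \<rhd> on2 T \<phi>) =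
        (\<phi> \<lhd> mult T (carr X)) \<bullet> (lmult Y \<lhd> on1 T (on1 T f))"
  shows "lax_morphism K T (Lax_Mor X Y f \<phi>)"
  using assms by (simp add: lax_morphism_def hom1_def hom2_def)

lemma algebra_cell_simps [simp]:
  assumes "algebra_cell K T \<Phi>"
  shows "lax_morphism K T (cell_src \<Phi>)" "lax_morphism K T (cell_trg \<Phi>)"
    "mor_src (cell_trg \<Phi>) = mor_src (cell_src \<Phi>)" "mor_trg (cell_trg \<Phi>) = mor_trg (cell_src \<Phi>)"
    "und2 \<Phi> \<in> Cells K" "src2 K (und2 \<Phi>) = und1 (cell_src \<Phi>)" "trg2 K (und2 \<Phi>) = und1 (cell_trg \<Phi>)"
  using assms by (auto simp: algebra_cell_def Let_def hom2_def)

lemma algebra_cell_law: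
  assumes "algebra_cell K T \<Phi>"
  shows "(und2 \<Phi> \<lhd> act (mor_src (cell_src \<Phi>))) \<bullet> mor_cell (cell_src \<Phi>) =
    mor_cell (cell_trg \<Phi>) \<bullet> (act (mor_trg (cell_src \<Phi>)) \<rhd> on2 T (und2 \<Phi>))"
  using assms unfolding algebra_cell_def Let_def by blast

lemma algebra_cellI:
  assumes "lax_morphism K T F" "lax_morphism K T G" "mor_src G = mor_src F" "mor_trg G = mor_trg F"
    "\<phi> \<in> Cells K" "src2 K \<phi> = und1 F" "trg2 K \<phi> = und1 G"
    "(\<phi> \<lhd> act (mor_src F)) \<bullet> mor_cell F = mor_cell G \<bullet> (act (mor_trg F) \<rhd> on2 T \<phi>)"
  shows "algebra_cell K T (Alg_Cell F G \<phi>)"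
  using assms by (simp add: algebra_cell_def hom2_def)

lemma id_mor_sel [simp]:
  "mor_src (id_mor K X) = X" "mor_trg (id_mor K X) = X" "und1 (id_mor K X) = id1 K (carr X)"
  "mor_cell (id_mor K X) = id2 K (act X)"
  by (simp_all add: id_mor_def)

lemma comp_mor_sel [simp]:
  "mor_src (comp_mor K T G F) = mor_src F" "mor_trg (comp_mor K T G F) = mor_trg G"
  "und1 (comp_mor K T G F) = und1 G \<cdot> und1 F"
  "mor_cell (comp_mor K T G F) =
    (und1 G \<rhd> mor_cell F) \<bullet> (mor_cell G \<lhd> on1 T (und1 F))"
  by (simp_all add: comp_mor_def)

lemma id_mor_lax [simp]:
  assumes "lax_algebra K T X"
  shows "lax_morphism K T (id_mor K X)"
  unfolding id_mor_def by (rule lax_morphismI) (use assms in simp_all)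

text \<open>The composite of comparison 2-cells satisfies each axiom by pasting the axiom for \<open>F\<close>, whiskered
  on the left by \<open>g\<close>, with the axiom for \<open>G\<close>, whiskered on the right by \<open>f\<close> or \<open>T T f\<close>. In the
  multiplication axiom the two pastings become adjacent only after the exchange of the comparison
  of \<open>G\<close> with the image under \<open>T\<close> of the comparison of \<open>F\<close>.\<close>

lemma comp_mor_lax [simp]:
  assumes F: "lax_morphism K T F" and G: "lax_morphism K T G" and FG: "mor_src G = mor_trg F"
  shows "lax_morphism K T (comp_mor K T G F)"
proof -
  let ?X = "mor_src F" and ?Y = "mor_trg F" and ?Z = "mor_trg G"
  let ?f = "und1 F" and ?g = "und1 G" and ?\<phi> = "mor_cell F" and ?\<psi> = "mor_cell G"
  note [simp] = F G FG
  have 1: "(?g \<cdot> ?f) \<rhd> lunit ?X =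
      (?g \<rhd> (?\<phi> \<lhd> unit T (carr ?X))) \<bullet> (?g \<rhd> (lunit ?Y \<lhd> ?f))"
    using arg_cong[OF lax_morphism_laws(1)[OF F], of "\<lambda>\<chi>. ?g \<rhd> \<chi>"] by simp
  have 2: "?g \<rhd> (lunit ?Y \<lhd> ?f) =
      (?\<psi> \<lhd> (unit T (carr ?Y) \<cdot> ?f)) \<bullet> (lunit ?Z \<lhd> (?g \<cdot> ?f))"
    using arg_cong[OF lax_morphism_laws(1)[OF G], of "\<lambda>\<chi>. \<chi> \<lhd> ?f"] by simp
  have 3: "((?g \<cdot> ?f) \<rhd> lmult ?X) \<bullet> (?g \<rhd> (?\<phi> \<lhd> on1 T (act ?X)))
        \<bullet> ((?g \<cdot> act ?Y) \<rhd> on2 T ?\<phi>) =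
      (?g \<rhd> (?\<phi> \<lhd> mult T (carr ?X))) \<bullet> (?g \<rhd> (lmult ?Y \<lhd> on1 T (on1 T ?f)))"
    using arg_cong[OF lax_morphism_laws(2)[OF F], of "\<lambda>\<chi>. ?g \<rhd> \<chi>"] by simp
  have 4: "(?g \<rhd> (lmult ?Y \<lhd> on1 T (on1 T ?f))) \<bullet> (?\<psi> \<lhd> (on1 T (act ?Y) \<cdot> on1 T (on1 T ?f)))
        \<bullet> (act ?Z \<rhd> (on2 T ?\<psi> \<lhd> on1 T (on1 T ?f))) =
      (?\<psi> \<lhd> (mult T (carr ?Y) \<cdot> on1 T (on1 T ?f)))
        \<bullet> (lmult ?Z \<lhd> (on1 T (on1 T ?g) \<cdot> on1 T (on1 T ?f)))"
    using arg_cong[OF lax_morphism_laws(2)[OF G], of "\<lambda>\<chi>. \<chi> \<lhd> on1 T (on1 T ?f)"] by simp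
  \<comment> \<open>The exchange that brings the two pastings next to each other.\<close>
  have 5: "(?\<psi> \<lhd> (on1 T ?f \<cdot> on1 T (act ?X))) \<bullet> ((act ?Z \<cdot> on1 T ?g) \<rhd> on2 T ?\<phi>) =
      ((?g \<cdot> act ?Y) \<rhd> on2 T ?\<phi>) \<bullet> (?\<psi> \<lhd> (on1 T (act ?Y) \<cdot> on1 T (on1 T ?f)))"
    using hcomp_right_first[of "on2 T ?\<phi>" ?\<psi>] hcomp_left_first[of "on2 T ?\<phi>" ?\<psi>] by simp
  let ?P = "(?g \<cdot> ?f) \<rhd> lmult ?X" and ?Q = "?g \<rhd> (?\<phi> \<lhd> on1 T (act ?X))"
    and ?S = "act ?Z \<rhd> (on2 T ?\<psi> \<lhd> on1 T (on1 T ?f))"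
  have "?P \<bullet> ?Q \<bullet> (?\<psi> \<lhd> (on1 T ?f \<cdot> on1 T (act ?X))) \<bullet> ((act ?Z \<cdot> on1 T ?g) \<rhd> on2 T ?\<phi>) \<bullet> ?S
    = ?P \<bullet> ?Q \<bullet> ((?g \<cdot> act ?Y) \<rhd> on2 T ?\<phi>)
        \<bullet> (?\<psi> \<lhd> (on1 T (act ?Y) \<cdot> on1 T (on1 T ?f))) \<bullet> ?S"
    by (subst vcomp_cong_2[OF 5]) simp_all
  also have "\<dots> = (?g \<rhd> (?\<phi> \<lhd> mult T (carr ?X))) \<bullet> (?g \<rhd> (lmult ?Y \<lhd> on1 T (on1 T ?f)))
        \<bullet> (?\<psi> \<lhd> (on1 T (act ?Y) \<cdot> on1 T (on1 T ?f))) \<bullet> ?S"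
    using arg_cong[OF 3, of "\<lambda>\<chi>. \<chi> \<bullet> ((?\<psi> \<lhd> (on1 T (act ?Y) \<cdot> on1 T (on1 T ?f))) \<bullet> ?S)"] by simp
  also have "\<dots> = (?g \<rhd> (?\<phi> \<lhd> mult T (carr ?X))) \<bullet> (?\<psi> \<lhd> (mult T (carr ?Y) \<cdot> on1 T (on1 T ?f)))
        \<bullet> (lmult ?Z \<lhd> (on1 T (on1 T ?g) \<cdot> on1 T (on1 T ?f)))"
    by (simp only: 4)
  finally have 6: "?P \<bullet> ?Q \<bullet> (?\<psi> \<lhd> (on1 T ?f \<cdot> on1 T (act ?X)))
        \<bullet> ((act ?Z \<cdot> on1 T ?g) \<rhd> on2 T ?\<phi>) \<bullet> ?S =
      (?g \<rhd> (?\<phi> \<lhd> mult T (carr ?X))) \<bullet> (?\<psi> \<lhd> (mult T (carr ?Y) \<cdot> on1 T (on1 T ?f)))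
        \<bullet> (lmult ?Z \<lhd> (on1 T (on1 T ?g) \<cdot> on1 T (on1 T ?f)))" .
  show ?thesis
    unfolding comp_mor_def by (rule lax_morphismI) (simp_all add: 1 2 6)
qed

lemma comp_mor_id [simp]:
  assumes "lax_morphism K T F"
  shows "mor_trg F = Y \<Longrightarrow> comp_mor K T (id_mor K Y) F = F"
    and "mor_src F = X \<Longrightarrow> comp_mor K T F (id_mor K X) = F"
  using assms by (auto intro!: lax_mor.expand)

lemma comp_mor_assoc:
  assumes "lax_morphism K T F" "lax_morphism K T G" "lax_morphism K T H"
    "mor_src G = mor_trg F" "mor_src H = mor_trg G"
  shows "comp_mor K T (comp_mor K T H G) F = comp_mor K T H (comp_mor K T G F)"
  using assms by (intro lax_mor.expand) simp

lemma vcomp_algebra_cell: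
  assumes a: "algebra_cell K T \<Phi>" and b: "algebra_cell K T \<Psi>" and c: "cell_src \<Psi> = cell_trg \<Phi>"
  shows "algebra_cell K T (Alg_Cell (cell_src \<Phi>) (cell_trg \<Psi>) (und2 \<Psi> \<bullet> und2 \<Phi>))"
proof -
  note [simp] = a b c
  let ?X = "mor_src (cell_src \<Phi>)" and ?Y = "mor_trg (cell_src \<Phi>)"
  have "(und2 \<Psi> \<lhd> act ?X) \<bullet> (und2 \<Phi> \<lhd> act ?X) \<bullet> mor_cell (cell_src \<Phi>) =
      (und2 \<Psi> \<lhd> act ?X) \<bullet> mor_cell (cell_trg \<Phi>) \<bullet> (act ?Y \<rhd> on2 T (und2 \<Phi>))"
    using algebra_cell_law[OF a] by simp
  also have "\<dots> = mor_cell (cell_trg \<Psi>) \<bullet> (act ?Y \<rhd> on2 T (und2 \<Psi>)) \<bullet> (act ?Y \<rhd> on2 T (und2 \<Phi>))"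
    by (rule vcomp_cong_2) (use algebra_cell_law[OF b] in simp_all)
  finally show ?thesis
    by (intro algebra_cellI) simp_all
qed

lemma whisker_left_algebra_cell:
  assumes a: "algebra_cell K T \<Phi>" and G: "lax_morphism K T G"
    and c: "mor_src G = mor_trg (cell_src \<Phi>)"
  shows "algebra_cell K T
    (Alg_Cell (comp_mor K T G (cell_src \<Phi>)) (comp_mor K T G (cell_trg \<Phi>)) (und1 G \<rhd> und2 \<Phi>))"
proof -
  note [simp] = a G c
  let ?F = "cell_src \<Phi>" and ?F' = "cell_trg \<Phi>" and ?g = "und1 G"
  let ?X = "mor_src ?F" and ?Y = "mor_trg ?F" and ?Z = "mor_trg G"
  have 1: "(?g \<rhd> (und2 \<Phi> \<lhd> act ?X)) \<bullet> (?g \<rhd> mor_cell ?F) =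
      (?g \<rhd> mor_cell ?F') \<bullet> ((?g \<cdot> act ?Y) \<rhd> on2 T (und2 \<Phi>))"
    using arg_cong[OF algebra_cell_law[OF a], of "\<lambda>\<chi>. ?g \<rhd> \<chi>"] by simp
  have 2: "((?g \<cdot> act ?Y) \<rhd> on2 T (und2 \<Phi>)) \<bullet> (mor_cell G \<lhd> on1 T (und1 ?F)) =
      (mor_cell G \<lhd> on1 T (und1 ?F')) \<bullet> ((act ?Z \<cdot> on1 T ?g) \<rhd> on2 T (und2 \<Phi>))"
    using hcomp_right_first[of "on2 T (und2 \<Phi>)" "mor_cell G"]
      hcomp_left_first[of "on2 T (und2 \<Phi>)" "mor_cell G"] by simp
  have "(?g \<rhd> (und2 \<Phi> \<lhd> act ?X)) \<bullet> (?g \<rhd> mor_cell ?F) \<bullet> (mor_cell G \<lhd> on1 T (und1 ?F)) =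
      (?g \<rhd> mor_cell ?F') \<bullet> (mor_cell G \<lhd> on1 T (und1 ?F'))
        \<bullet> ((act ?Z \<cdot> on1 T ?g) \<rhd> on2 T (und2 \<Phi>))"
    by (subst vcomp_cong_2[OF 1]) (simp_all add: 2)
  then show ?thesis
    by (intro algebra_cellI) simp_all
qed

lemma whisker_right_algebra_cell:
  assumes a: "algebra_cell K T \<Psi>" and F: "lax_morphism K T F"
    and c: "mor_src (cell_src \<Psi>) = mor_trg F"
  shows "algebra_cell K T
    (Alg_Cell (comp_mor K T (cell_src \<Psi>) F) (comp_mor K T (cell_trg \<Psi>) F) (und2 \<Psi> \<lhd> und1 F))"
proof -
  note [simp] = a F c
  let ?G = "cell_src \<Psi>" and ?G' = "cell_trg \<Psi>" and ?f = "und1 F"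
  let ?X = "mor_src F" and ?Y = "mor_trg F" and ?Z = "mor_trg (cell_src \<Psi>)"
  have 1: "(und2 \<Psi> \<lhd> (?f \<cdot> act ?X)) \<bullet> (und1 ?G \<rhd> mor_cell F) =
      (und1 ?G' \<rhd> mor_cell F) \<bullet> (und2 \<Psi> \<lhd> (act ?Y \<cdot> on1 T ?f))"
    using hcomp_right_first[of "mor_cell F" "und2 \<Psi>"]
      hcomp_left_first[of "mor_cell F" "und2 \<Psi>"] by simp
  have 2: "(und2 \<Psi> \<lhd> (act ?Y \<cdot> on1 T ?f)) \<bullet> (mor_cell ?G \<lhd> on1 T ?f) =
      (mor_cell ?G' \<lhd> on1 T ?f) \<bullet> (act ?Z \<rhd> (on2 T (und2 \<Psi>) \<lhd> on1 T ?f))"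
    using arg_cong[OF algebra_cell_law[OF a], of "\<lambda>\<chi>. \<chi> \<lhd> on1 T ?f"] by simp
  have "(und2 \<Psi> \<lhd> (?f \<cdot> act ?X)) \<bullet> (und1 ?G \<rhd> mor_cell F) \<bullet> (mor_cell ?G \<lhd> on1 T ?f) =
      (und1 ?G' \<rhd> mor_cell F) \<bullet> (mor_cell ?G' \<lhd> on1 T ?f)
        \<bullet> (act ?Z \<rhd> (on2 T (und2 \<Psi>) \<lhd> on1 T ?f))"
    by (subst vcomp_cong_2[OF 1]) (simp_all add: 2)
  then show ?thesis
    by (intro algebra_cellI) simp_all
qed

text \<open>Splitting the horizontal composite into two whiskerings reduces the claim to the two lemmas above.\<close>

lemma hcomp_algebra_cell:
  assumes "algebra_cell K T \<Phi>" "algebra_cell K T \<Psi>" "mor_src (cell_src \<Psi>) = mor_trg (cell_src \<Phi>)"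
  shows "algebra_cell K T (Alg_Cell (comp_mor K T (cell_src \<Psi>) (cell_src \<Phi>))
    (comp_mor K T (cell_trg \<Psi>) (cell_trg \<Phi>)) (und2 \<Psi> \<star> und2 \<Phi>))"
  using vcomp_algebra_cell[OF whisker_left_algebra_cell[of \<Phi> "cell_src \<Psi>"]
      whisker_right_algebra_cell[of \<Psi> "cell_trg \<Phi>"]] assms
  by (simp add: hcomp_right_first[of "und2 \<Phi>" "und2 \<Psi>"])

lemma id2_algebra_cell:
  assumes "lax_morphism K T F"
  shows "algebra_cell K T (Alg_Cell F F (id2 K (und1 F)))"
  by (rule algebra_cellI) (use assms in simp_all)

lemma LaxAlg_sel [simp]:
  "Obj (LaxAlg K T) = {X. lax_algebra K T X}"
  "Loose (LaxAlg K T) = {F. lax_morphism K T F}"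
  "Tight (LaxAlg K T) = {F. pseudo_morphism K T F \<and> und1 F \<in> Tight K}"
  "Cells (LaxAlg K T) = {\<Phi>. algebra_cell K T \<Phi>}"
  "src (LaxAlg K T) = mor_src" "trg (LaxAlg K T) = mor_trg"
  "id1 (LaxAlg K T) = id_mor K" "comp1 (LaxAlg K T) = comp_mor K T"
  "src2 (LaxAlg K T) = cell_src" "trg2 (LaxAlg K T) = cell_trg"
  "id2 (LaxAlg K T) F = Alg_Cell F F (id2 K (und1 F))"
  "vcomp (LaxAlg K T) \<Psi> \<Phi> = Alg_Cell (cell_src \<Phi>) (cell_trg \<Psi>) (und2 \<Psi> \<bullet> und2 \<Phi>)"
  "hcomp (LaxAlg K T) \<Psi> \<Phi> = Alg_Cell (comp_mor K T (cell_src \<Psi>) (cell_src \<Phi>))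
       (comp_mor K T (cell_trg \<Psi>) (cell_trg \<Phi>)) (und2 \<Psi> \<star> und2 \<Phi>)"
  by (simp_all add: LaxAlg_def)

lemma hom1_LaxAlg [simp]:
  "F \<in> hom1 (LaxAlg K T) X Y \<longleftrightarrow> lax_morphism K T F \<and> mor_src F = X \<and> mor_trg F = Y"
  by (simp add: hom1_def)

lemma hom2_LaxAlg [simp]:
  "\<Phi> \<in> hom2 (LaxAlg K T) F G \<longleftrightarrow> algebra_cell K T \<Phi> \<and> cell_src \<Phi> = F \<and> cell_trg \<Phi> = G"
  by (simp add: hom2_def)

lemma alg_cell_eqI:
  "\<lbrakk>cell_src \<Phi> = cell_src \<Psi>; cell_trg \<Phi> = cell_trg \<Psi>; und2 \<Phi> = und2 \<Psi>\<rbrakk> \<Longrightarrow> \<Phi> = \<Psi>"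
  by (rule alg_cell.expand) simp

lemma two_category_LaxAlg: "two_category (LaxAlg K T)"
proof (unfold_locales, unfold hom1_LaxAlg hom2_LaxAlg, goal_cases)
  case (17 F A B G C \<Phi> F' \<Psi> G')
  then show ?case using hcomp_algebra_cell[of \<Phi> \<Psi>] by auto
next
  case (19 F A B G C \<Phi> F' \<Phi>' F'' \<Psi> G' \<Psi>' G'')
  then show ?case
    by (intro alg_cell_eqI) (auto intro!: interchange_cells)
next
  case (20 F A B \<Phi> F')
  then show ?case by (intro alg_cell_eqI) auto
next
  case (21 F A B \<Phi> F')
  then show ?case by (intro alg_cell_eqI) auto
next
  case (22 F A B G C H D \<Phi> F' \<Psi> G' \<Xi> H')
  then show ?case by (intro alg_cell_eqI) (auto intro!: comp_mor_assoc)
qed (auto simp: comp_mor_assoc id2_algebra_cell vcomp_algebra_cell intro: alg_cell_eqI)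

section \<open>Tight 1-cells and the terminal algebra\<close>

lemma enhanced_LaxAlg: "enhanced_two_category (LaxAlg K T)"
proof -
  interpret L: two_category "LaxAlg K T" by (rule two_category_LaxAlg)
  show ?thesis
  proof (unfold_locales, goal_cases)
    case 1
    then show ?case by (auto simp: pseudo_morphism_def)
  next
    case (2 X)
    then show ?case by (auto simp: pseudo_morphism_def iso2_id2 tight_id1)
  next
    case (3 F G)
    then have F: "lax_morphism K T F" "iso2 K (mor_cell F)" "und1 F \<in> Tight K"
      and G: "lax_morphism K T G" "iso2 K (mor_cell G)" "und1 G \<in> Tight K"
      and c: "mor_src G = mor_trg F"
      by (auto simp: pseudo_morphism_def)
    have "iso2 K (mor_cell (comp_mor K T G F))"
      using F G c by (auto intro!: iso2_vcomp iso2_whisker_left iso2_whisker_right)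
    moreover have "und1 G \<cdot> und1 F \<in> Tight K"
      using F G c by (auto intro!: tight_comp1)
    ultimately show ?case using F G c by (simp add: pseudo_morphism_def)
  qed
qed

lemma iso2_LaxAlg_und2:
  assumes "iso2 (LaxAlg K T) \<Phi>"
  shows "iso2 K (und2 \<Phi>)"
proof -
  obtain \<Psi> where p: "algebra_cell K T \<Phi>" "algebra_cell K T \<Psi>" "cell_src \<Psi> = cell_trg \<Phi>"
    "cell_trg \<Psi> = cell_src \<Phi>" "und2 \<Psi> \<bullet> und2 \<Phi> = id2 K (und1 (cell_src \<Phi>))"
    "und2 \<Phi> \<bullet> und2 \<Psi> = id2 K (und1 (cell_trg \<Phi>))"
    using assms unfolding iso2_def by auto
  show ?thesis unfolding iso2_iff
    by (intro conjI bexI[of _ "und2 \<Psi>"]) (use p in simp_all)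
qed

text \<open>The 2-morphism equation expresses the comparison of the codomain as a composite of the comparison
  of the domain with whiskerings of \<open>\<Phi>\<close> and of its inverse.\<close>

lemma pseudo_transfer:
  assumes a: "algebra_cell K T \<Phi>" and i: "iso2 K (und2 \<Phi>)"
    and F: "iso2 K (mor_cell (cell_src \<Phi>))"
  shows "iso2 K (mor_cell (cell_trg \<Phi>))"
proof -
  let ?F = "cell_src \<Phi>" and ?G = "cell_trg \<Phi>"
  let ?X = "mor_src ?F" and ?Y = "mor_trg ?F"
  note [simp] = a
  obtain \<psi> where p: "\<psi> \<in> Cells K" "src2 K \<psi> = und1 ?G" "trg2 K \<psi> = und1 ?F"
    "\<psi> \<bullet> und2 \<Phi> = id2 K (und1 ?F)" "und2 \<Phi> \<bullet> \<psi> = id2 K (und1 ?G)"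
    using i a by (auto elim!: iso2_inverse)
  have inv: "(act ?Y \<rhd> on2 T (und2 \<Phi>)) \<bullet> (act ?Y \<rhd> on2 T \<psi>) = id2 K (act ?Y \<cdot> on1 T (und1 ?G))"
    using arg_cong[OF p(5), of "\<lambda>\<chi>. act ?Y \<rhd> on2 T \<chi>"] p(1-3) by simp
  have "mor_cell ?G = mor_cell ?G \<bullet> (act ?Y \<rhd> on2 T (und2 \<Phi>)) \<bullet> (act ?Y \<rhd> on2 T \<psi>)"
    using inv by simp
  also have "\<dots> = (und2 \<Phi> \<lhd> act ?X) \<bullet> mor_cell ?F \<bullet> (act ?Y \<rhd> on2 T \<psi>)"
    by (rule vcomp_cong_2) (use p(1-3) algebra_cell_law[OF a] in simp_all)
  finally have e: "mor_cell ?G = (und2 \<Phi> \<lhd> act ?X) \<bullet> mor_cell ?F \<bullet> (act ?Y \<rhd> on2 T \<psi>)" .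
  have inv': "(act ?Y \<rhd> on2 T \<psi>) \<bullet> (act ?Y \<rhd> on2 T (und2 \<Phi>)) = id2 K (act ?Y \<cdot> on1 T (und1 ?F))"
    using arg_cong[OF p(4), of "\<lambda>\<chi>. act ?Y \<rhd> on2 T \<chi>"] p(1-3) by simp
  have "iso2 K (act ?Y \<rhd> on2 T \<psi>)"
    unfolding iso2_iff
    by (intro conjI bexI[of _ "act ?Y \<rhd> on2 T (und2 \<Phi>)"]) (use p(1-3) inv inv' in simp_all)
  then show ?thesis
    unfolding e by (intro iso2_vcomp iso2_whisker_right i F) (use p(1-3) in simp_all)
qed

lemma replete_LaxAlg:
  assumes rep: "\<And>f g. \<lbrakk>f \<in> Tight K; g \<in> Loose K; isomorphic1 K f g\<rbrakk> \<Longrightarrow> g \<in> Tight K"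
    and F: "F \<in> Tight (LaxAlg K T)" and i: "isomorphic1 (LaxAlg K T) F G"
  shows "G \<in> Tight (LaxAlg K T)"
proof -
  obtain \<Phi> where p: "algebra_cell K T \<Phi>" "cell_src \<Phi> = F" "cell_trg \<Phi> = G"
    and j: "iso2 (LaxAlg K T) \<Phi>"
    using i unfolding isomorphic1_def by auto
  note k = iso2_LaxAlg_und2[OF j]
  have "isomorphic1 K (und1 F) (und1 G)"
    unfolding isomorphic1_def using k p by (auto intro!: bexI[of _ "und2 \<Phi>"] hom2I)
  moreover have "iso2 K (mor_cell G)"
    using pseudo_transfer[OF p(1) k] p F by (simp add: pseudo_morphism_def)
  moreover have "lax_morphism K T G"
    using p by auto
  ultimately show ?thesis
    using F rep[of "und1 F" "und1 G"] by (simp add: pseudo_morphism_def)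
qed

text \<open>All data and all axioms live in hom-categories into the terminal object, where any two parallel
  2-cells are equal and every 2-cell is invertible.\<close>

lemma tight_terminal_LaxAlg:
  assumes I: "tight_terminal_object K I"
  shows "\<exists>J. tight_terminal_object (LaxAlg K T) J"
proof -
  have tI: "terminal_object K I" and tight: "\<And>f. \<lbrakk>f \<in> Loose K; trg K f = I\<rbrakk> \<Longrightarrow> f \<in> Tight K"
    using I src_obj unfolding tight_terminal_object_def hom1_def by auto
  have O[simp]: "I \<in> Obj K" using tI unfolding terminal_object_def by simp
  obtain t where t[simp]: "t \<in> Loose K" "src K t = on0 T I" "trg K t = I"
    by (rule terminal_ex1[OF tI on0_simps[OF O]])
  obtain u where u[simp]: "u \<in> Cells K" "src2 K u = id1 K I" "trg2 K u = t \<cdot> unit T I"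
    by (rule terminal_ex2[OF tI, of "id1 K I" "t \<cdot> unit T I"]) simp_all
  obtain m where m[simp]: "m \<in> Cells K" "src2 K m = t \<cdot> on1 T t" "trg2 K m = t \<cdot> mult T I"
    by (rule terminal_ex2[OF tI, of "t \<cdot> on1 T t" "t \<cdot> mult T I"]) simp_all
  let ?J = "Lax_Alg I t u m"
  have J[simp]: "lax_algebra K T ?J"
    unfolding lax_algebra_def Let_def lax_alg.sel
    by (intro conjI hom1I hom2I tight; (rule terminal_eq2[OF tI])?) simp_all
  have ex: "\<exists>F. lax_morphism K T F \<and> mor_src F = X \<and> mor_trg F = ?J"
    if X[simp]: "lax_algebra K T X" for X
  proof -
    obtain f where f[simp]: "f \<in> Loose K" "src K f = carr X" "trg K f = I"
      by (rule terminal_ex1[OF tI, of "carr X"]) simp_all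
    obtain \<phi> where p[simp]: "\<phi> \<in> Cells K" "src2 K \<phi> = t \<cdot> on1 T f" "trg2 K \<phi> = f \<cdot> act X"
      by (rule terminal_ex2[OF tI, of "t \<cdot> on1 T f" "f \<cdot> act X"]) simp_all
    have "lax_morphism K T (Lax_Mor X ?J f \<phi>)"
      by (rule lax_morphismI; (rule terminal_eq2[OF tI])?) simp_all
    then show ?thesis by (intro exI[of _ "Lax_Mor X ?J f \<phi>"]) simp
  qed
  have uniq: "F = G" if "lax_morphism K T F" "lax_morphism K T G" "mor_src F = mor_src G"
      "mor_trg F = ?J" "mor_trg G = ?J" for F G
  proof -
    have 1: "und1 F = und1 G"
      by (rule terminal_eq1[OF tI]) (use that in simp_all)
    have "mor_cell F = mor_cell G"
      by (rule terminal_eq2[OF tI]) (use that 1 in simp_all)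
    then show ?thesis using 1 that by (intro lax_mor.expand) simp
  qed
  have cell: "\<exists>!\<Phi>. algebra_cell K T \<Phi> \<and> cell_src \<Phi> = F \<and> cell_trg \<Phi> = G"
    if F[simp]: "lax_morphism K T F" "mor_trg F = ?J" and e: "G = F" for F G
  proof (rule ex1I)
    show "algebra_cell K T (Alg_Cell F G (id2 K (und1 F))) \<and>
        cell_src (Alg_Cell F G (id2 K (und1 F))) = F \<and> cell_trg (Alg_Cell F G (id2 K (und1 F))) = G"
      using id2_algebra_cell[OF F(1)] e by simp
    show "\<Phi> = Alg_Cell F G (id2 K (und1 F))"
      if "algebra_cell K T \<Phi> \<and> cell_src \<Phi> = F \<and> cell_trg \<Phi> = G" for \<Phi>
    proof -
      have "und2 \<Phi> = id2 K (und1 F)"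
        by (rule terminal_eq2[OF tI]) (use that e in auto)
      then show ?thesis using that by (intro alg_cell_eqI) simp_all
    qed
  qed
  have "pseudo_morphism K T F \<and> und1 F \<in> Tight K" if "lax_morphism K T F" "mor_trg F = ?J" for F
    unfolding pseudo_morphism_def
    by (intro conjI that terminal_iso2[OF tI] tight) (use that in simp_all)
  moreover have "\<exists>!F. lax_morphism K T F \<and> mor_src F = X \<and> mor_trg F = ?J"
    if "lax_algebra K T X" for X
    using ex[OF that] uniq by blast
  moreover have "\<exists>!\<Phi>. algebra_cell K T \<Phi> \<and> cell_src \<Phi> = F \<and> cell_trg \<Phi> = G"
    if "lax_morphism K T F" "mor_trg F = ?J" "lax_morphism K T G" "mor_trg G = ?J"
      "mor_src F = mor_src G" for F G
    by (rule cell) (use that uniq in auto)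
  ultimately have "tight_terminal_object (LaxAlg K T) ?J"
    unfolding tight_terminal_object_def terminal_object_def by auto
  then show ?thesis ..
qed

section \<open>Strict morphisms over discrete opfibrations\<close>

lemma strict_morphism_lax [simp]: "strict_morphism K T P \<Longrightarrow> lax_morphism K T P"
  by (simp add: strict_morphism_def)

lemma strict_morphism_cell [simp]:
  assumes "strict_morphism K T P"
  shows "mor_cell P = id2 K (act (mor_trg P) \<cdot> on1 T (und1 P))"
proof -
  obtain h where "lax_morphism K T P" "h \<in> Loose K" "mor_cell P = id2 K h"
    using assms unfolding strict_morphism_def by blast
  then show ?thesis using lax_morphism_simps(7)[of P] by simp
qed

text \<open>For a strict morphism the unit and multiplication axioms become plain equations. They are oriented
  so that \<open>p\<close> moves to the right, past the structure of its source, with versions for use inside a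
  longer composite. The domain algebra is a separate variable \<open>E\<close>, since \<open>mor_src P\<close>
  has usually been rewritten when these rules are to fire.\<close>

lemma strict_morphism_act [simp]:
  assumes P: "strict_morphism K T P" and "mor_src P = E"
  shows "und1 P \<cdot> act E = act (mor_trg P) \<cdot> on1 T (und1 P)"
  using lax_morphism_simps(8)[of P] assms by simp

lemma strict_morphism_act_assoc [simp]:
  assumes P: "strict_morphism K T P" and E: "mor_src P = E"
    and x: "x \<in> Loose K" "trg K x = on0 T (carr E)"
  shows "und1 P \<cdot> (act E \<cdot> x) = act (mor_trg P) \<cdot> (on1 T (und1 P) \<cdot> x)"
  using arg_cong[OF strict_morphism_act[OF P E], of "\<lambda>f. f \<cdot> x"] assms lax_morphism_simps(1)[of P]
  by (simp del: strict_morphism_act)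

lemma strict_morphism_T_act [simp]:
  assumes P: "strict_morphism K T P" and E: "mor_src P = E"
  shows "on1 T (und1 P) \<cdot> on1 T (act E) = on1 T (act (mor_trg P)) \<cdot> on1 T (on1 T (und1 P))"
  using arg_cong[OF strict_morphism_act[OF P E], of "on1 T"] assms lax_morphism_simps(1)[of P]
  by (simp del: strict_morphism_act)

lemma strict_morphism_laws [simp]:
  assumes P: "strict_morphism K T P" and E: "mor_src P = E"
  shows "und1 P \<rhd> lunit E = lunit (mor_trg P) \<lhd> und1 P"
    and "und1 P \<rhd> lmult E = lmult (mor_trg P) \<lhd> on1 T (on1 T (und1 P))"
proof -
  note [simp] = P E
  have [simp]: "lax_algebra K T E" using lax_morphism_simps(1)[of P] by simp
  show "und1 P \<rhd> lunit E = lunit (mor_trg P) \<lhd> und1 P"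
    using lax_morphism_laws(1)[of P] by simp
  show "und1 P \<rhd> lmult E = lmult (mor_trg P) \<lhd> on1 T (on1 T (und1 P))"
    using lax_morphism_laws(2)[of P] by simp
qed

lemma strict_morphism_laws_assoc [simp]:
  assumes P: "strict_morphism K T P" and E: "mor_src P = E" and x: "x \<in> Loose K"
  shows "trg K x = carr E \<Longrightarrow> und1 P \<rhd> (lunit E \<lhd> x) = lunit (mor_trg P) \<lhd> (und1 P \<cdot> x)"
    and "trg K x = on0 T (on0 T (carr E)) \<Longrightarrow>
      und1 P \<rhd> (lmult E \<lhd> x) = lmult (mor_trg P) \<lhd> (on1 T (on1 T (und1 P)) \<cdot> x)"
proof -
  note [simp] = P E x
  have [simp]: "lax_algebra K T E" using lax_morphism_simps(1)[of P] by simp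
  show "und1 P \<rhd> (lunit E \<lhd> x) = lunit (mor_trg P) \<lhd> (und1 P \<cdot> x)" if "trg K x = carr E"
    using arg_cong[OF strict_morphism_laws(1)[OF P E], of "\<lambda>\<chi>. \<chi> \<lhd> x"] that
    by (simp del: strict_morphism_laws)
  show "und1 P \<rhd> (lmult E \<lhd> x) = lmult (mor_trg P) \<lhd> (on1 T (on1 T (und1 P)) \<cdot> x)"
    if "trg K x = on0 T (on0 T (carr E))"
    using arg_cong[OF strict_morphism_laws(2)[OF P E], of "\<lambda>\<chi>. \<chi> \<lhd> x"] that
    by (simp del: strict_morphism_laws)
qed

lemma comp_strict_cell:
  assumes "strict_morphism K T P" "lax_morphism K T F" "mor_src P = mor_trg F"
  shows "mor_cell (comp_mor K T P F) = und1 P \<rhd> mor_cell F"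
  using assms by simp

lemma comp_cell_strict:
  assumes "strict_morphism K T P" "lax_morphism K T G" "mor_src G = mor_trg P"
  shows "mor_cell (comp_mor K T G P) = mor_cell G \<lhd> on1 T (und1 P)"
  using assms by simp

text \<open>Each axiom compares two 2-cells with the same domain, and \<open>p\<close> sends it to the corresponding axiom of
  \<open>X\<close> whiskered by a power of \<open>T\<close> applied to \<open>p\<close>.\<close>

lemma lax_algebra_reflect:
  assumes d: "tight_discrete_opfibration K p" and p: "p \<in> Loose K" "src K p = Q" "trg K p = carr X"
    and X: "lax_algebra K T X"
    and pi: "\<pi> \<in> Loose K" "\<pi> \<in> Tight K" "src K \<pi> = on0 T Q" "trg K \<pi> = Q"
    and u: "\<upsilon> \<in> Cells K" "src2 K \<upsilon> = id1 K Q" "trg2 K \<upsilon> = \<pi> \<cdot> unit T Q"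
    and m: "\<mu> \<in> Cells K" "src2 K \<mu> = \<pi> \<cdot> on1 T \<pi>" "trg2 K \<mu> = \<pi> \<cdot> mult T Q"
    and e: "p \<cdot> \<pi> = act X \<cdot> on1 T p" "p \<rhd> \<upsilon> = lunit X \<lhd> p" "p \<rhd> \<mu> = lmult X \<lhd> on1 T (on1 T p)"
  shows "lax_algebra K T (Lax_Alg Q \<pi> \<upsilon> \<mu>)"
proof -
  note [simp] = p X pi u m e
  have Q[simp]: "Q \<in> Obj K" using src_obj[OF p(1)] by simp
  have Tpi[simp]: "on1 T p \<cdot> on1 T \<pi> = on1 T (act X) \<cdot> on1 T (on1 T p)"
    by (rule on1_square) simp_all
  have TTpi[simp]: "on1 T (on1 T p) \<cdot> on1 T (on1 T \<pi>) =
      on1 T (on1 T (act X)) \<cdot> on1 T (on1 T (on1 T p))"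
    by (rule on1_square) simp_all
  have pi'[simp]: "p \<cdot> (\<pi> \<cdot> x) = act X \<cdot> (on1 T p \<cdot> x)" if "x \<in> Loose K" "trg K x = on0 T Q" for x
    by (rule comp1_square_assoc) (use that in simp_all)
  have u'[simp]: "p \<rhd> (\<upsilon> \<lhd> x) = lunit X \<lhd> (p \<cdot> x)" if "x \<in> Loose K" "trg K x = Q" for x
    using arg_cong[OF e(2), of "\<lambda>\<chi>. \<chi> \<lhd> x"] that by (simp del: e(2))
  have m'[simp]: "p \<rhd> (\<mu> \<lhd> x) = lmult X \<lhd> (on1 T (on1 T p) \<cdot> x)"
    if "x \<in> Loose K" "trg K x = on0 T (on0 T Q)" for x
    using arg_cong[OF e(3), of "\<lambda>\<chi>. \<chi> \<lhd> x"] that by (simp del: e(3))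
  have Tu[simp]: "(act X \<cdot> on1 T p) \<rhd> on2 T \<upsilon> = act X \<rhd> (on2 T (lunit X) \<lhd> on1 T p)"
    using arg_cong[OF e(2), of "\<lambda>\<chi>. act X \<rhd> on2 T \<chi>"] by (simp del: e(2))
  have Tm[simp]: "(act X \<cdot> on1 T p) \<rhd> on2 T \<mu> =
      act X \<rhd> (on2 T (lmult X) \<lhd> on1 T (on1 T (on1 T p)))"
    using arg_cong[OF e(3), of "\<lambda>\<chi>. act X \<rhd> on2 T \<chi>"] by (simp del: e(3))
  note laws = lax_algebra_laws[OF X]
  have 1: "(\<mu> \<lhd> unit T (on0 T Q)) \<bullet> (\<upsilon> \<lhd> \<pi>) = id2 K \<pi>"
    by (rule dopf_unique[OF d]) (use arg_cong[OF laws(1), of "\<lambda>\<chi>. \<chi> \<lhd> on1 T p"] in simp_all)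
  have 2: "(\<mu> \<lhd> on1 T (unit T Q)) \<bullet> (\<pi> \<rhd> on2 T \<upsilon>) = id2 K \<pi>"
  proof -
    have [simp]: "on1 T (on1 T p) \<cdot> on1 T (unit T Q) = on1 T (unit T (carr X)) \<cdot> on1 T p"
      by (rule on1_square) simp_all
    show ?thesis
      by (rule dopf_unique[OF d]) (use arg_cong[OF laws(2), of "\<lambda>\<chi>. \<chi> \<lhd> on1 T p"] in simp_all)
  qed
  have 3: "(\<mu> \<lhd> mult T (on0 T Q)) \<bullet> (\<mu> \<lhd> on1 T (on1 T \<pi>)) =
      (\<mu> \<lhd> on1 T (mult T Q)) \<bullet> (\<pi> \<rhd> on2 T \<mu>)"
  proof -
    have [simp]: "on1 T (on1 T p) \<cdot> on1 T (mult T Q) =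
        on1 T (mult T (carr X)) \<cdot> on1 T (on1 T (on1 T p))"
      by (rule on1_square) simp_all
    show ?thesis
      by (rule dopf_unique[OF d])
        (use arg_cong[OF laws(3), of "\<lambda>\<chi>. \<chi> \<lhd> on1 T (on1 T (on1 T p))"] in simp_all)
  qed
  show ?thesis
    unfolding lax_algebra_def Let_def lax_alg.sel
    by (intro conjI hom1I hom2I 1 2 3) simp_all
qed

text \<open>The hypothesis on \<open>(p \<cdot> e, p \<rhd> \<epsilon>)\<close> is that the composite with the strict morphism \<open>P\<close> is lax; it
  is spelled out because the composite of morphisms makes sense only once the conclusion is known.\<close>

lemma lax_morphism_reflect:
  assumes P: "strict_morphism K T P" and d: "tight_discrete_opfibration K (und1 P)"
    and X: "lax_algebra K T X" and E: "mor_src P = E" and B: "mor_trg P = B"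
    and e: "e \<in> Loose K" "src K e = carr X" "trg K e = carr E"
    and c: "\<epsilon> \<in> Cells K" "src2 K \<epsilon> = act E \<cdot> on1 T e" "trg2 K \<epsilon> = e \<cdot> act X"
    and l: "lax_morphism K T (Lax_Mor X B (und1 P \<cdot> e) (und1 P \<rhd> \<epsilon>))"
  shows "lax_morphism K T (Lax_Mor X E e \<epsilon>)"
proof -
  note [simp] = P X E B e c
  have [simp]: "lax_algebra K T E" "lax_algebra K T B"
    using lax_morphism_simps(1,2)[of P] by simp_all
  have "e \<rhd> lunit X = (\<epsilon> \<lhd> unit T (carr X)) \<bullet> (lunit E \<lhd> e)"
    by (rule dopf_unique[OF d]) (use lax_morphism_laws(1)[OF l] in simp_all)
  moreover have "(e \<rhd> lmult X) \<bullet> (\<epsilon> \<lhd> on1 T (act X)) \<bullet> (act E \<rhd> on2 T \<epsilon>) =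
      (\<epsilon> \<lhd> mult T (carr X)) \<bullet> (lmult E \<lhd> on1 T (on1 T e))"
    by (rule dopf_unique[OF d]) (use lax_morphism_laws(2)[OF l] in simp_all)
  ultimately show ?thesis by (intro lax_morphismI) simp_all
qed

lemma algebra_cell_reflect:
  assumes P: "strict_morphism K T P" and d: "tight_discrete_opfibration K (und1 P)"
    and F: "lax_morphism K T F" "lax_morphism K T G" "mor_src G = mor_src F"
      "mor_trg G = mor_trg F" "mor_src P = mor_trg F"
    and c: "\<chi> \<in> Cells K" "src2 K \<chi> = und1 F" "trg2 K \<chi> = und1 G"
    and l: "algebra_cell K T (Alg_Cell (comp_mor K T P F) (comp_mor K T P G) (und1 P \<rhd> \<chi>))"
  shows "algebra_cell K T (Alg_Cell F G \<chi>)"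
proof -
  note [simp] = P F c
  have "(\<chi> \<lhd> act (mor_src F)) \<bullet> mor_cell F = mor_cell G \<bullet> (act (mor_trg F) \<rhd> on2 T \<chi>)"
    by (rule dopf_unique[OF d]) (use algebra_cell_law[OF l] in simp_all)
  then show ?thesis by (intro algebra_cellI) simp_all
qed

lemma strict_pseudo:
  assumes "strict_morphism K T P"
  shows "pseudo_morphism K T P"
  using assms unfolding pseudo_morphism_def by (simp add: iso2_id2)

text \<open>The lift of \<open>\<Phi>\<close> starts with the lift \<open>\<chi>\<close> of its underlying 2-cell, with codomain \<open>e\<close>. The lift \<open>\<epsilon>\<close> of the
  comparison of the codomain of \<open>\<Phi>\<close> makes \<open>e\<close> a lax morphism. The codomain of \<open>\<epsilon>\<close> comes from the
  2-morphism equation for \<open>\<chi>\<close>: both sides lift the equation for \<open>\<Phi>\<close> and start at the same 1-cell.\<close>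

lemma dopf_LaxAlg:
  assumes P: "strict_morphism K T P" and d: "tight_discrete_opfibration K (und1 P)"
  shows "tight_discrete_opfibration (LaxAlg K T) P"
proof -
  let ?E = "mor_src P" and ?B = "mor_trg P" and ?p = "und1 P"
  note [simp] = P
  have "\<exists>!\<chi>. algebra_cell K T \<chi> \<and> cell_src \<chi> = F \<and>
      Alg_Cell (comp_mor K T P (cell_src \<chi>)) (comp_mor K T P (cell_trg \<chi>)) (?p \<rhd> und2 \<chi>) = \<Phi>"
    if F[simp]: "lax_morphism K T F" "mor_trg F = ?E" and Phi: "algebra_cell K T \<Phi>"
      "cell_src \<Phi> = comp_mor K T P F" for F \<Phi>
  proof -
    let ?X = "mor_src F" and ?b = "und1 (cell_trg \<Phi>)"
    note [simp] = Phi
    have [simp]: "lax_morphism K T (cell_trg \<Phi>)" "mor_src (cell_trg \<Phi>) = ?X"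
      "mor_trg (cell_trg \<Phi>) = ?B" "src2 K (und2 \<Phi>) = ?p \<cdot> und1 F"
      using algebra_cell_simps[OF Phi(1)] by simp_all
    obtain \<chi> where \<chi>[simp]: "\<chi> \<in> Cells K" "src2 K \<chi> = und1 F"
      and p\<chi>: "?p \<rhd> \<chi> = und2 \<Phi>" "?p \<cdot> trg2 K \<chi> = ?b"
      by (rule dopf_lift[OF d, of "und1 F" "und2 \<Phi>"]) simp_all
    define e where "e = trg2 K \<chi>"
    have e[simp]: "trg2 K \<chi> = e" "e \<in> Loose K" "src K e = carr ?X" "trg K e = carr ?E"
      unfolding e_def by simp_all
    have pe: "?p \<cdot> e = ?b" using p\<chi>(2) by simp
    have Tpe: "on1 T ?p \<cdot> on1 T e = on1 T ?b"
      using arg_cong[OF pe, of "on1 T"] by simp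
    obtain \<epsilon> where \<epsilon>[simp]: "\<epsilon> \<in> Cells K" "src2 K \<epsilon> = act ?E \<cdot> on1 T e"
      and p\<epsilon>: "?p \<rhd> \<epsilon> = mor_cell (cell_trg \<Phi>)"
      by (rule dopf_lift[OF d, of "act ?E \<cdot> on1 T e" "mor_cell (cell_trg \<Phi>)"])
        (simp_all add: Tpe)
    have b: "(act ?B \<cdot> on1 T ?p) \<rhd> on2 T \<chi> = act ?B \<rhd> on2 T (und2 \<Phi>)"
      using arg_cong[OF p\<chi>(1), of "\<lambda>\<zeta>. act ?B \<rhd> on2 T \<zeta>"] by simp
    have x: "?p \<rhd> (\<chi> \<lhd> act ?X) = und2 \<Phi> \<lhd> act ?X"
      using arg_cong[OF p\<chi>(1), of "\<lambda>\<zeta>. \<zeta> \<lhd> act ?X"] by simp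
    have law: "(\<chi> \<lhd> act ?X) \<bullet> mor_cell F = \<epsilon> \<bullet> (act ?E \<rhd> on2 T \<chi>)"
      by (rule dopf_unique[OF d]) (use algebra_cell_law[OF Phi(1)] in \<open>simp_all add: b x p\<epsilon>\<close>)
    have "trg2 K (\<epsilon> \<bullet> (act ?E \<rhd> on2 T \<chi>)) = trg2 K \<epsilon>"
      by simp
    then have t[simp]: "trg2 K \<epsilon> = e \<cdot> act ?X"
      unfolding law[symmetric] by simp
    let ?G = "Lax_Mor ?X ?E e \<epsilon>"
    have G[simp]: "lax_morphism K T ?G"
    proof (rule lax_morphism_reflect[OF P d])
      have "Lax_Mor ?X ?B (?p \<cdot> e) (?p \<rhd> \<epsilon>) = cell_trg \<Phi>"
        by (rule lax_mor.expand) (simp add: pe p\<epsilon>)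
      then show "lax_morphism K T (Lax_Mor ?X ?B (?p \<cdot> e) (?p \<rhd> \<epsilon>))" by simp
    qed simp_all
    have PG: "comp_mor K T P ?G = cell_trg \<Phi>"
      by (rule lax_mor.expand) (simp add: pe Tpe p\<epsilon>)
    show ?thesis
    proof (rule ex1I[of _ "Alg_Cell F ?G \<chi>"], intro conjI)
      show "algebra_cell K T (Alg_Cell F ?G \<chi>)"
        by (rule algebra_cellI) (simp_all add: law)
      show "Alg_Cell (comp_mor K T P (cell_src (Alg_Cell F ?G \<chi>)))
          (comp_mor K T P (cell_trg (Alg_Cell F ?G \<chi>))) (?p \<rhd> und2 (Alg_Cell F ?G \<chi>)) = \<Phi>"
        by (rule alg_cell_eqI) (simp_all add: PG p\<chi>)
      fix \<zeta>
      assume z: "algebra_cell K T \<zeta> \<and> cell_src \<zeta> = F \<and> Alg_Cell (comp_mor K T P (cell_src \<zeta>))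
        (comp_mor K T P (cell_trg \<zeta>)) (?p \<rhd> und2 \<zeta>) = \<Phi>"
      then have z1[simp]: "algebra_cell K T \<zeta>" "cell_src \<zeta> = F"
        and z2: "comp_mor K T P (cell_trg \<zeta>) = cell_trg \<Phi>" "?p \<rhd> und2 \<zeta> = und2 \<Phi>"
        by auto
      have z3[simp]: "lax_morphism K T (cell_trg \<zeta>)" "mor_src (cell_trg \<zeta>) = ?X"
        "mor_trg (cell_trg \<zeta>) = ?E"
        using algebra_cell_simps[OF z1(1)] by simp_all
      have u: "und2 \<zeta> = \<chi>"
        by (rule dopf_unique[OF d]) (simp_all add: z2 p\<chi>)
      have e': "und1 (cell_trg \<zeta>) = e"
        using algebra_cell_simps(7)[OF z1(1)] by (simp add: u)
      have "mor_cell (cell_trg \<zeta>) = \<epsilon>"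
        by (rule dopf_unique[OF d])
          (use arg_cong[OF z2(1), of mor_cell] in \<open>simp_all add: e' p\<epsilon> Tpe\<close>)
      then have "cell_trg \<zeta> = ?G"
        by (intro lax_mor.expand) (simp add: e')
      then show "\<zeta> = Alg_Cell F ?G \<chi>"
        by (intro alg_cell_eqI) (simp_all add: u)
    qed simp
  qed
  then show ?thesis
    using d strict_pseudo[OF P] unfolding tight_discrete_opfibration_def by simp
qed

section \<open>Pullbacks along lax morphisms\<close>

text \<open>The data of a chosen pullback of lax algebras over a pullback downstairs with projections \<open>r\<close> and
  \<open>q\<close>. Only a commuting square is required, as its universal property follows from the one
  downstairs; this keeps the condition stable under pasting.\<close>

definition lax_square where
  "lax_square P G R S r q \<longleftrightarrow> strict_morphism K T R \<and> lax_morphism K T S \<and>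
    mor_src S = mor_src R \<and> mor_trg R = mor_src G \<and> mor_trg S = mor_src P \<and>
    und1 R = r \<and> und1 S = q \<and> comp_mor K T P S = comp_mor K T G R"

lemma lax_square_exists:
  assumes P: "strict_morphism K T P" and G: "lax_morphism K T G" "mor_trg G = mor_trg P"
    and d: "tight_discrete_opfibration K (und1 P)" and dr: "tight_discrete_opfibration K r"
    and pb: "left_tight_pullback K (und1 P) (und1 G) r q"
  obtains R S where "lax_square P G R S r q"
proof -
  let ?p = "und1 P" and ?g = "und1 G" and ?A = "mor_src G" and ?E = "mor_src P"
    and ?B = "mor_trg P" and ?Q = "src K r"
  have tpb: "two_pullback K ?p ?g r q" and rt: "r \<in> Tight K"
    and det: "\<And>h. \<lbrakk>h \<in> Loose K; trg K h = ?Q; r \<cdot> h \<in> Tight K\<rbrakk> \<Longrightarrow> h \<in> Tight K"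
    using pb src_obj unfolding left_tight_pullback_def hom1_def by auto
  note pbs = two_pullback_simps[OF tpb]
  note [simp] = P G pbs(4-9)
  have A[simp]: "lax_algebra K T ?A" and E[simp]: "lax_algebra K T ?E" "lax_algebra K T ?B"
    using lax_morphism_simps(1,2)[of P] lax_morphism_simps(1)[of G] by simp_all
  have [simp]: "trg K r = carr ?A" "trg K q = carr ?E" "?Q \<in> Obj K" by simp_all
  have Tsq[simp]: "on1 T ?p \<cdot> on1 T q = on1 T ?g \<cdot> on1 T r"
    by (rule on1_square) simp_all
  have TTsq[simp]: "on1 T (on1 T ?p) \<cdot> on1 T (on1 T q) = on1 T (on1 T ?g) \<cdot> on1 T (on1 T r)"
    by (rule on1_square) simp_all
  \<comment> \<open>The comparison of \<open>q\<close>. Its codomain becomes \<open>q \<cdot> \<pi>\<close> by the choice of the action \<open>\<pi>\<close>.\<close>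
  obtain \<kappa> where \<kappa>[simp]: "\<kappa> \<in> Cells K" "src2 K \<kappa> = act ?E \<cdot> on1 T q"
    and p\<kappa>: "?p \<rhd> \<kappa> = mor_cell G \<lhd> on1 T r" "?p \<cdot> trg2 K \<kappa> = trg2 K (mor_cell G \<lhd> on1 T r)"
    by (rule dopf_lift[OF d, of "act ?E \<cdot> on1 T q" "mor_cell G \<lhd> on1 T r"]) simp_all
  have \<kappa>'[simp]: "?p \<rhd> (\<kappa> \<lhd> x) = mor_cell G \<lhd> (on1 T r \<cdot> x)"
    if "x \<in> Loose K" "trg K x = on0 T ?Q" for x
    using arg_cong[OF p\<kappa>(1), of "\<lambda>\<chi>. \<chi> \<lhd> x"] that by simp
  have T\<kappa>[simp]: "(act ?B \<cdot> on1 T ?p) \<rhd> on2 T \<kappa> = act ?B \<rhd> (on2 T (mor_cell G) \<lhd> on1 T (on1 T r))"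
    using arg_cong[OF p\<kappa>(1), of "\<lambda>\<chi>. act ?B \<rhd> on2 T \<chi>"] by simp
  obtain \<pi> where \<pi>[simp]: "\<pi> \<in> Loose K" "src K \<pi> = on0 T ?Q" "trg K \<pi> = ?Q"
    and r\<pi>[simp]: "r \<cdot> \<pi> = act ?A \<cdot> on1 T r" and q\<pi>: "q \<cdot> \<pi> = trg2 K \<kappa>"
    by (rule two_pullback_ex1[OF tpb, of "act ?A \<cdot> on1 T r" "trg2 K \<kappa>"])
      (use p\<kappa>(2) in simp_all)
  have t\<kappa>[simp]: "trg2 K \<kappa> = q \<cdot> \<pi>" by (simp add: q\<pi>)
  have \<pi>t: "\<pi> \<in> Tight K"
    by (rule det) (use on1_tight[OF rt] in \<open>auto intro!: tight_comp1\<close>)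
  have r\<pi>'[simp]: "r \<cdot> (\<pi> \<cdot> x) = act ?A \<cdot> (on1 T r \<cdot> x)" if "x \<in> Loose K" "trg K x = on0 T ?Q" for x
    by (rule comp1_square_assoc) (use that in simp_all)
  have Tr\<pi>[simp]: "on1 T r \<cdot> on1 T \<pi> = on1 T (act ?A) \<cdot> on1 T (on1 T r)"
    by (rule on1_square) simp_all
  \<comment> \<open>The unit law of \<open>q\<close> comes first, since it is what determines the codomain of \<open>\<upsilon>\<close>.\<close>
  obtain \<upsilon> where u[simp]: "\<upsilon> \<in> Cells K" "src2 K \<upsilon> = id1 K ?Q"
    and ru: "r \<rhd> \<upsilon> = lunit ?A \<lhd> r" "r \<cdot> trg2 K \<upsilon> = trg2 K (lunit ?A \<lhd> r)"
    by (rule dopf_lift[OF dr, of "id1 K ?Q" "lunit ?A \<lhd> r"]) simp_all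
  have gru: "(?g \<cdot> r) \<rhd> \<upsilon> = ?g \<rhd> (lunit ?A \<lhd> r)"
    using arg_cong[OF ru(1), of "\<lambda>\<chi>. ?g \<rhd> \<chi>"] by simp
  have qu: "q \<rhd> \<upsilon> = (\<kappa> \<lhd> unit T ?Q) \<bullet> (lunit ?E \<lhd> q)"
    by (rule dopf_unique[OF d])
      (use arg_cong[OF lax_morphism_laws(1)[OF G(1)], of "\<lambda>\<chi>. \<chi> \<lhd> r"] in \<open>simp_all add: gru\<close>)
  have tu[simp]: "trg2 K \<upsilon> = \<pi> \<cdot> unit T ?Q"
  proof (rule two_pullback_eq1[OF tpb])
    show "q \<cdot> trg2 K \<upsilon> = q \<cdot> (\<pi> \<cdot> unit T ?Q)"
      using arg_cong[OF qu, of "trg2 K"] by simp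
  qed (use ru(2) in simp_all)
  \<comment> \<open>The multiplication law of \<open>q\<close> determines the codomain of \<open>\<mu>\<close> in the same way.\<close>
  obtain \<mu> where m[simp]: "\<mu> \<in> Cells K" "src2 K \<mu> = \<pi> \<cdot> on1 T \<pi>"
    and rm: "r \<rhd> \<mu> = lmult ?A \<lhd> on1 T (on1 T r)"
      "r \<cdot> trg2 K \<mu> = trg2 K (lmult ?A \<lhd> on1 T (on1 T r))"
    by (rule dopf_lift[OF dr, of "\<pi> \<cdot> on1 T \<pi>" "lmult ?A \<lhd> on1 T (on1 T r)"]) simp_all
  have grm: "(?g \<cdot> r) \<rhd> \<mu> = ?g \<rhd> (lmult ?A \<lhd> on1 T (on1 T r))"
    using arg_cong[OF rm(1), of "\<lambda>\<chi>. ?g \<rhd> \<chi>"] by simp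
  have qm: "(q \<rhd> \<mu>) \<bullet> (\<kappa> \<lhd> on1 T \<pi>) \<bullet> (act ?E \<rhd> on2 T \<kappa>) =
      (\<kappa> \<lhd> mult T ?Q) \<bullet> (lmult ?E \<lhd> on1 T (on1 T q))"
    by (rule dopf_unique[OF d])
      (use arg_cong[OF lax_morphism_laws(2)[OF G(1)], of "\<lambda>\<chi>. \<chi> \<lhd> on1 T (on1 T r)"]
        in \<open>simp_all add: grm\<close>)
  have tm[simp]: "trg2 K \<mu> = \<pi> \<cdot> mult T ?Q"
  proof (rule two_pullback_eq1[OF tpb])
    show "q \<cdot> trg2 K \<mu> = q \<cdot> (\<pi> \<cdot> mult T ?Q)"
      using arg_cong[OF qm, of "trg2 K"] by simp
  qed (use rm(2) in simp_all)
  let ?X = "Lax_Alg ?Q \<pi> \<upsilon> \<mu>"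
  have X[simp]: "lax_algebra K T ?X"
    by (rule lax_algebra_reflect[OF dr _ refl _ A]) (simp_all add: \<pi>t ru rm)
  let ?R = "Lax_Mor ?X ?A r (id2 K (act ?A \<cdot> on1 T r))" and ?S = "Lax_Mor ?X ?E q \<kappa>"
  have "lax_morphism K T ?R"
    by (rule lax_morphismI) (simp_all add: ru rm)
  then have "strict_morphism K T ?R"
    unfolding strict_morphism_def by (auto intro!: bexI[of _ "act ?A \<cdot> on1 T r"])
  moreover have "lax_morphism K T ?S"
    by (rule lax_morphismI) (simp_all add: qu qm)
  moreover have "comp_mor K T P ?S = comp_mor K T G ?R"
    by (rule lax_mor.expand) (simp add: p\<kappa>)
  ultimately have "lax_square P G ?R ?S r q"
    unfolding lax_square_def by simp
  then show thesis by (rule that)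
qed

lemma lax_square_simps:
  assumes "lax_square P G R S r q" "strict_morphism K T P" "lax_morphism K T G" "mor_trg G = mor_trg P"
  shows "strict_morphism K T R" "lax_morphism K T S"
    "mor_src S = mor_src R" "mor_trg R = mor_src G" "mor_trg S = mor_src P"
    "und1 R = r" "und1 S = q" "und1 P \<cdot> q = und1 G \<cdot> r"
    "und1 P \<rhd> mor_cell S = mor_cell G \<lhd> on1 T r"
    "r \<in> Loose K" "src K r = carr (mor_src R)" "trg K r = carr (mor_src G)"
    "q \<in> Loose K" "src K q = carr (mor_src R)" "trg K q = carr (mor_src P)"
proof -
  show s[simp]: "strict_morphism K T R" "lax_morphism K T S"
    "mor_src S = mor_src R" "mor_trg R = mor_src G" "mor_trg S = mor_src P"
    "und1 R = r" "und1 S = q"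
    using assms(1) unfolding lax_square_def by auto
  have c: "comp_mor K T P S = comp_mor K T G R"
    using assms(1) unfolding lax_square_def by auto
  note [simp] = assms(2-4)
  show "und1 P \<cdot> q = und1 G \<cdot> r"
    using arg_cong[OF c, of und1] by simp
  show t: "r \<in> Loose K" "src K r = carr (mor_src R)" "trg K r = carr (mor_src G)"
    "q \<in> Loose K" "src K q = carr (mor_src R)" "trg K q = carr (mor_src P)"
    using lax_morphism_simps[of R] lax_morphism_simps[of S] by simp_all
  show "und1 P \<rhd> mor_cell S = mor_cell G \<lhd> on1 T r"
    using arg_cong[OF c, of mor_cell] comp_strict_cell[of P S] comp_cell_strict[of R G] by simp
qed

text \<open>The comparison of \<open>S\<close> is a lift along \<open>P\<close> with prescribed domain; it fixes \<open>q \<cdot> \<pi>\<close> and strictness fixes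
  \<open>r \<cdot> \<pi>\<close>, hence the action \<open>\<pi>\<close>; the unit and multiplication are lifts along \<open>r\<close>.\<close>

lemma lax_square_unique:
  assumes P: "strict_morphism K T P" and G: "lax_morphism K T G" "mor_trg G = mor_trg P"
    and d: "tight_discrete_opfibration K (und1 P)" and dr: "tight_discrete_opfibration K r"
    and pb: "two_pullback K (und1 P) (und1 G) r q"
    and 1: "lax_square P G R S r q" and 2: "lax_square P G R' S' r q"
  shows "R = R' \<and> S = S'"
proof -
  note s1 = lax_square_simps[OF 1 P G] and s2 = lax_square_simps[OF 2 P G]
  note [simp] = P G s1(1-7) s2(1-7)
  let ?Q = "mor_src R" and ?Q' = "mor_src R'"
  have Q[simp]: "lax_algebra K T ?Q" "lax_algebra K T ?Q'"
    using lax_morphism_simps(1)[of R] lax_morphism_simps(1)[of R'] by simp_all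
  have c: "carr ?Q' = carr ?Q" using s1(11) s2(11) by simp
  note [simp] = s1(10,12,13,15) c s1(11,14)
  have E: "lax_algebra K T (mor_src P)" using P by simp
  have k: "mor_cell S' = mor_cell S"
    by (rule dopf_unique[OF d]) (use E s1(9) s2(9) in simp_all)
  have a: "act ?Q' = act ?Q"
  proof (rule two_pullback_eq1[OF pb])
    show "r \<cdot> act ?Q' = r \<cdot> act ?Q"
      using strict_morphism_act[of R] strict_morphism_act[of R'] by simp
    show "q \<cdot> act ?Q' = q \<cdot> act ?Q"
      using lax_morphism_simps(8)[of S] lax_morphism_simps(8)[of S'] k by simp
  qed simp_all
  have u: "lunit ?Q' = lunit ?Q"
    by (rule dopf_unique[OF dr])
      (use strict_morphism_laws(1)[of R] strict_morphism_laws(1)[of R'] in simp_all)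
  have m: "lmult ?Q' = lmult ?Q"
    by (rule dopf_unique[OF dr])
      (use strict_morphism_laws(2)[of R] strict_morphism_laws(2)[of R'] a in simp_all)
  have q: "?Q' = ?Q" by (rule lax_alg.expand) (simp add: c a u m)
  have "R = R'" by (rule lax_mor.expand) (simp add: q)
  moreover have "S = S'" by (rule lax_mor.expand) (simp add: q k)
  ultimately show ?thesis by simp
qed

lemma lax_square_id:
  assumes "strict_morphism K T P"
  shows "lax_square P (id_mor K (mor_trg P)) P (id_mor K (mor_src P)) (und1 P) (id1 K (carr (mor_src P)))"
  using assms unfolding lax_square_def by auto

lemma lax_square_comp:
  assumes P: "strict_morphism K T P" and G: "lax_morphism K T G" "mor_trg G = mor_trg P"
    and H: "lax_morphism K T H" "mor_trg H = mor_src G"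
    and 1: "lax_square P G R S r q" and 2: "lax_square R H R' S' r' q'"
  shows "lax_square P (comp_mor K T G H) R' (comp_mor K T S S') r' (q \<cdot> q')"
proof -
  note s1 = lax_square_simps[OF 1 P G]
  have e: "mor_trg H = mor_trg R" using H s1(4) by simp
  note s2 = lax_square_simps[OF 2 s1(1) H(1) e]
  note [simp] = P G H s1(1-7) s2(1-7)
  have "comp_mor K T P S = comp_mor K T G R" "comp_mor K T R S' = comp_mor K T H R'"
    using 1 2 unfolding lax_square_def by auto
  then have "comp_mor K T P (comp_mor K T S S') = comp_mor K T (comp_mor K T G H) R'"
    using comp_mor_assoc[of S' S P] comp_mor_assoc[of S' R G] comp_mor_assoc[of R' H G] by simp
  then show ?thesis unfolding lax_square_def by simp
qed

text \<open>The comparison \<open>\<eta>\<close> of the mediating morphism is the lift along \<open>r\<close> of the comparison of \<open>U\<close>. Its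
  codomain is found by the pullback property from its images under \<open>r\<close> and \<open>q\<close>; for the latter,
  \<open>V_eq\<close> identifies the comparison of the composite with \<open>S\<close> with that of \<open>V\<close> by comparing them
  downstairs.\<close>

lemma lax_square_ex1:
  assumes P: "strict_morphism K T P" and G: "lax_morphism K T G" "mor_trg G = mor_trg P"
    and d: "tight_discrete_opfibration K (und1 P)" and dr: "tight_discrete_opfibration K r"
    and pb: "two_pullback K (und1 P) (und1 G) r q"
    and sq: "lax_square P G R S r q"
    and U: "lax_morphism K T U" "mor_trg U = mor_src G"
    and V: "lax_morphism K T V" "mor_trg V = mor_src P" "mor_src V = mor_src U"
    and UV: "comp_mor K T P V = comp_mor K T G U"
  obtains H where "lax_morphism K T H" "mor_src H = mor_src U" "mor_trg H = mor_src R"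
    "comp_mor K T R H = U" "comp_mor K T S H = V"
proof -
  note s = lax_square_simps[OF sq P G]
  note [simp] = P G s U V
  let ?p = "und1 P" and ?g = "und1 G" and ?u = "und1 U" and ?v = "und1 V"
    and ?X = "mor_src U" and ?Q = "mor_src R" and ?E = "mor_src P" and ?A = "mor_src G"
  have [simp]: "lax_algebra K T ?Q" "lax_algebra K T ?E" "lax_algebra K T ?X" "lax_algebra K T ?A"
    using lax_morphism_simps(1)[of R] lax_morphism_simps(1)[of P] lax_morphism_simps(1)[of U]
      lax_morphism_simps(1)[of G] by simp_all
  have e: "?p \<cdot> ?v = ?g \<cdot> ?u" using arg_cong[OF UV, of und1] by simp
  have ce: "?p \<rhd> mor_cell V = (?g \<rhd> mor_cell U) \<bullet> (mor_cell G \<lhd> on1 T ?u)"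
    using arg_cong[OF UV, of mor_cell] comp_strict_cell[of P V] by simp
  obtain h where h[simp]: "h \<in> Loose K" "src K h = carr ?X" "trg K h = carr ?Q"
    and rh: "r \<cdot> h = ?u" and qh: "q \<cdot> h = ?v"
    by (rule two_pullback_ex1[OF pb, of ?u ?v]) (simp_all add: e)
  have rh'[simp]: "r \<cdot> (h \<cdot> x) = ?u \<cdot> x" if "x \<in> Loose K" "trg K x = carr ?X" for x
    using arg_cong[OF rh, of "\<lambda>f. f \<cdot> x"] that by simp
  have qh'[simp]: "q \<cdot> (h \<cdot> x) = ?v \<cdot> x" if "x \<in> Loose K" "trg K x = carr ?X" for x
    using arg_cong[OF qh, of "\<lambda>f. f \<cdot> x"] that by simp
  have Trh[simp]: "on1 T r \<cdot> on1 T h = on1 T ?u" using arg_cong[OF rh, of "on1 T"] by simp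
  have Tqh[simp]: "on1 T q \<cdot> on1 T h = on1 T ?v" using arg_cong[OF qh, of "on1 T"] by simp
  have ract[simp]: "r \<cdot> act ?Q = act ?A \<cdot> on1 T r"
    using strict_morphism_act[of R] by simp
  have ract'[simp]: "r \<cdot> (act ?Q \<cdot> x) = act ?A \<cdot> (on1 T r \<cdot> x)"
    if "x \<in> Loose K" "trg K x = on0 T (carr ?Q)" for x
    using strict_morphism_act_assoc[of R] that by simp
  obtain \<eta> where \<eta>[simp]: "\<eta> \<in> Cells K" "src2 K \<eta> = act ?Q \<cdot> on1 T h"
    and r\<eta>: "r \<rhd> \<eta> = mor_cell U" "r \<cdot> trg2 K \<eta> = trg2 K (mor_cell U)"
    by (rule dopf_lift[OF dr, of "act ?Q \<cdot> on1 T h" "mor_cell U"]) simp_all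
  have gr\<eta>: "(?g \<cdot> r) \<rhd> \<eta> = ?g \<rhd> mor_cell U"
    using arg_cong[OF r\<eta>(1), of "\<lambda>\<chi>. ?g \<rhd> \<chi>"] by simp
  have p\<kappa>: "?p \<rhd> (mor_cell S \<lhd> on1 T h) = mor_cell G \<lhd> on1 T ?u"
    using arg_cong[OF s(9), of "\<lambda>\<chi>. \<chi> \<lhd> on1 T h"] by (simp del: s(9))
  have V_eq: "(q \<rhd> \<eta>) \<bullet> (mor_cell S \<lhd> on1 T h) = mor_cell V"
    by (rule dopf_unique[OF d]) (simp_all add: gr\<eta> p\<kappa> ce)
  have t[simp]: "trg2 K \<eta> = h \<cdot> act ?X"
  proof (rule two_pullback_eq1[OF pb])
    show "q \<cdot> trg2 K \<eta> = q \<cdot> (h \<cdot> act ?X)"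
      using arg_cong[OF V_eq, of "trg2 K"] by simp
  qed (use r\<eta>(2) in simp_all)
  let ?H = "Lax_Mor ?X ?Q h \<eta>"
  have "lax_morphism K T ?H"
  proof (rule lax_morphism_reflect[of R, OF _ _ _ refl s(4)])
    have "Lax_Mor ?X ?A (und1 R \<cdot> h) (und1 R \<rhd> \<eta>) = U"
      by (rule lax_mor.expand) (simp add: rh r\<eta>)
    then show "lax_morphism K T (Lax_Mor ?X ?A (und1 R \<cdot> h) (und1 R \<rhd> \<eta>))" by simp
  qed (simp_all add: dr)
  moreover have "comp_mor K T R ?H = U"
    by (rule lax_mor.expand) (simp add: rh r\<eta>)
  moreover have "comp_mor K T S ?H = V"
    by (rule lax_mor.expand) (simp add: qh V_eq)
  ultimately show thesis using that[of ?H] by simp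
qed

lemma lax_square_eq1:
  assumes P: "strict_morphism K T P" and G: "lax_morphism K T G" "mor_trg G = mor_trg P"
    and dr: "tight_discrete_opfibration K r"
    and pb: "two_pullback K (und1 P) (und1 G) r q"
    and sq: "lax_square P G R S r q"
    and H: "lax_morphism K T H" "mor_trg H = mor_src R"
    and H': "lax_morphism K T H'" "mor_trg H' = mor_src R" "mor_src H' = mor_src H"
    and eq: "comp_mor K T R H = comp_mor K T R H'" "comp_mor K T S H = comp_mor K T S H'"
  shows "H = H'"
proof -
  note s = lax_square_simps[OF sq P G]
  note [simp] = P G s H H'
  have [simp]: "lax_algebra K T (mor_src R)" using lax_morphism_simps(1)[of R] by simp
  have h: "und1 H = und1 H'"
    by (rule two_pullback_eq1[OF pb])
      (use arg_cong[OF eq(1), of und1] arg_cong[OF eq(2), of und1] in simp_all)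
  have "r \<rhd> mor_cell H = r \<rhd> mor_cell H'"
    using arg_cong[OF eq(1), of mor_cell] comp_strict_cell[of R H] comp_strict_cell[of R H'] by simp
  then have "mor_cell H = mor_cell H'"
    by (rule dopf_unique[OF dr, rotated -1]) (simp_all add: h)
  then show ?thesis by (intro lax_mor.expand) (simp add: h)
qed

lemma two_pullback_LaxAlg:
  assumes P: "strict_morphism K T P" and G: "lax_morphism K T G" "mor_trg G = mor_trg P"
    and d: "tight_discrete_opfibration K (und1 P)" and dr: "tight_discrete_opfibration K r"
    and pb: "two_pullback K (und1 P) (und1 G) r q"
    and sq: "lax_square P G R S r q"
  shows "two_pullback (LaxAlg K T) P G R S"
proof -
  note s = lax_square_simps[OF sq P G]
  note [simp] = P G s
  have c: "comp_mor K T P S = comp_mor K T G R" using sq unfolding lax_square_def by simp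
  have ex1: "\<exists>!H. (lax_morphism K T H \<and> mor_src H = X \<and> mor_trg H = mor_src R) \<and>
      comp_mor K T R H = U \<and> comp_mor K T S H = V"
    if U: "lax_morphism K T U \<and> mor_src U = X \<and> mor_trg U = mor_src G"
      and V: "lax_morphism K T V \<and> mor_src V = X \<and> mor_trg V = mor_src P"
      and UV: "comp_mor K T P V = comp_mor K T G U" for X U V
  proof -
    obtain H where "lax_morphism K T H" "mor_src H = mor_src U" "mor_trg H = mor_src R"
        "comp_mor K T R H = U" "comp_mor K T S H = V"
      by (rule lax_square_ex1[OF P G d dr pb sq, of U V]) (use U V UV in auto)
    then show ?thesis
      using U by (intro ex1I[of _ H]) (auto intro!: lax_square_eq1[OF P G dr pb sq])
  qed
  have ex2: "\<exists>!\<chi>. (algebra_cell K T \<chi> \<and> cell_src \<chi> = H \<and> cell_trg \<chi> = H') \<and>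
      Alg_Cell (comp_mor K T R (cell_src \<chi>)) (comp_mor K T R (cell_trg \<chi>)) (r \<rhd> und2 \<chi>) = \<sigma> \<and>
      Alg_Cell (comp_mor K T S (cell_src \<chi>)) (comp_mor K T S (cell_trg \<chi>)) (q \<rhd> und2 \<chi>) = \<tau>"
    if H[simp]: "lax_morphism K T H" "mor_trg H = mor_src R"
      and H'[simp]: "lax_morphism K T H'" "mor_src H' = mor_src H" "mor_trg H' = mor_src R"
      and \<sigma>[simp]: "algebra_cell K T \<sigma>" "cell_src \<sigma> = comp_mor K T R H" "cell_trg \<sigma> = comp_mor K T R H'"
      and \<tau>[simp]: "algebra_cell K T \<tau>" "cell_src \<tau> = comp_mor K T S H" "cell_trg \<tau> = comp_mor K T S H'"
      and e: "und1 P \<rhd> und2 \<tau> = und1 G \<rhd> und2 \<sigma>" for H H' \<sigma> \<tau>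
  proof -
    have [simp]: "lax_algebra K T (mor_src R)" using lax_morphism_simps(1)[of R] by simp
    have b[simp]: "src2 K (und2 \<sigma>) = r \<cdot> und1 H" "trg2 K (und2 \<sigma>) = r \<cdot> und1 H'"
      "src2 K (und2 \<tau>) = q \<cdot> und1 H" "trg2 K (und2 \<tau>) = q \<cdot> und1 H'"
      using algebra_cell_simps[OF \<sigma>(1)] algebra_cell_simps[OF \<tau>(1)] by simp_all
    obtain \<chi> where \<chi>[simp]: "\<chi> \<in> Cells K" "src2 K \<chi> = und1 H" "trg2 K \<chi> = und1 H'"
      and r\<chi>: "r \<rhd> \<chi> = und2 \<sigma>" "q \<rhd> \<chi> = und2 \<tau>"
      by (rule two_pullback_ex2[OF pb, of "und1 H" "und1 H'" "und2 \<sigma>" "und2 \<tau>"]) (simp_all add: e)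
    have "Alg_Cell (comp_mor K T R H) (comp_mor K T R H') (und1 R \<rhd> \<chi>) = \<sigma>"
      by (rule alg_cell_eqI) (simp_all add: r\<chi>)
    then have "algebra_cell K T (Alg_Cell (comp_mor K T R H) (comp_mor K T R H') (und1 R \<rhd> \<chi>))"
      using \<sigma>(1) by (simp only:)
    then have "algebra_cell K T (Alg_Cell H H' \<chi>)"
      by (rule algebra_cell_reflect[of R, rotated -1]) (simp_all add: dr)
    note cell = this
    show ?thesis
    proof (rule ex1I[of _ "Alg_Cell H H' \<chi>"])
      have "Alg_Cell (comp_mor K T R H) (comp_mor K T R H') (r \<rhd> \<chi>) = \<sigma>"
        "Alg_Cell (comp_mor K T S H) (comp_mor K T S H') (q \<rhd> \<chi>) = \<tau>"
        by (rule alg_cell_eqI; simp add: r\<chi>)+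
      then show "(algebra_cell K T (Alg_Cell H H' \<chi>) \<and> cell_src (Alg_Cell H H' \<chi>) = H \<and>
          cell_trg (Alg_Cell H H' \<chi>) = H') \<and>
        Alg_Cell (comp_mor K T R (cell_src (Alg_Cell H H' \<chi>)))
          (comp_mor K T R (cell_trg (Alg_Cell H H' \<chi>))) (r \<rhd> und2 (Alg_Cell H H' \<chi>)) = \<sigma> \<and>
        Alg_Cell (comp_mor K T S (cell_src (Alg_Cell H H' \<chi>)))
          (comp_mor K T S (cell_trg (Alg_Cell H H' \<chi>))) (q \<rhd> und2 (Alg_Cell H H' \<chi>)) = \<tau>"
        unfolding alg_cell.sel by (intro conjI cell refl)
    next
      fix \<zeta>
      assume z: "(algebra_cell K T \<zeta> \<and> cell_src \<zeta> = H \<and> cell_trg \<zeta> = H') \<and>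
        Alg_Cell (comp_mor K T R (cell_src \<zeta>)) (comp_mor K T R (cell_trg \<zeta>)) (r \<rhd> und2 \<zeta>) = \<sigma> \<and>
        Alg_Cell (comp_mor K T S (cell_src \<zeta>)) (comp_mor K T S (cell_trg \<zeta>)) (q \<rhd> und2 \<zeta>) = \<tau>"
      then have z1: "algebra_cell K T \<zeta>" "cell_src \<zeta> = H" "cell_trg \<zeta> = H'"
        and "Alg_Cell (comp_mor K T R (cell_src \<zeta>)) (comp_mor K T R (cell_trg \<zeta>)) (r \<rhd> und2 \<zeta>) = \<sigma>"
        by blast+
      from arg_cong[OF this(4), of und2] have z2: "r \<rhd> und2 \<zeta> = und2 \<sigma>" by simp
      have "und2 \<zeta> = \<chi>"
        by (rule dopf_unique[OF dr]) (use z1 z2 r\<chi> in simp_all)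
      then show "\<zeta> = Alg_Cell H H' \<chi>"
        using z1 by (intro alg_cell_eqI) simp_all
    qed
  qed
  show ?thesis
    unfolding two_pullback_def
  proof (intro conjI ballI impI, goal_cases)
    case (7 X U V)
    then show ?case using ex1[of U X V] by simp
  next
    case (8 X H H' \<sigma> \<tau>)
    then show ?case using ex2[of H H' \<sigma> \<tau>] by simp
  qed (simp_all add: c)
qed

text \<open>Tightness of the underlying 1-cell is detected by the pullback downstairs, and invertibility of the
  comparison because \<open>r\<close>, as a discrete opfibration, reflects isomorphisms.\<close>

lemma left_tight_pullback_LaxAlg:
  assumes P: "strict_morphism K T P" and G: "lax_morphism K T G" "mor_trg G = mor_trg P"
    and d: "tight_discrete_opfibration K (und1 P)" and dr: "tight_discrete_opfibration K r"
    and pb: "left_tight_pullback K (und1 P) (und1 G) r q"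
    and sq: "lax_square P G R S r q"
  shows "left_tight_pullback (LaxAlg K T) P G R S"
proof -
  have tpb: "two_pullback K (und1 P) (und1 G) r q" and t: "und1 P \<in> Tight K" "r \<in> Tight K"
    and det: "\<And>h. \<lbrakk>h \<in> Loose K; trg K h = src K r; r \<cdot> h \<in> Tight K\<rbrakk> \<Longrightarrow> h \<in> Tight K"
    using pb src_obj unfolding left_tight_pullback_def hom1_def by auto
  note s = lax_square_simps[OF sq P G]
  note [simp] = P G s
  have "pseudo_morphism K T H \<and> und1 H \<in> Tight K"
    if H[simp]: "lax_morphism K T H" "mor_trg H = mor_src R"
      and c: "pseudo_morphism K T (comp_mor K T R H)" "r \<cdot> und1 H \<in> Tight K" for H
  proof -
    have [simp]: "lax_algebra K T (mor_src R)" using lax_morphism_simps(1)[of R] by simp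
    have "iso2 K (r \<rhd> mor_cell H)"
      using c(1) comp_strict_cell[of R H] unfolding pseudo_morphism_def by simp
    then have "iso2 K (mor_cell H)"
      by (rule dopf_reflects_iso[OF dr, rotated -1]) simp_all
    then show ?thesis using det[OF _ _ c(2)] by (simp add: pseudo_morphism_def)
  qed
  then show ?thesis
    using two_pullback_LaxAlg[OF P G d dr tpb sq] strict_pseudo[OF P] strict_pseudo[OF s(1)] t
    unfolding left_tight_pullback_def by simp
qed

end

section \<open>The plumbus of lax algebras\<close>

theorem proposition6p11:
  fixes K :: "('o, 'a, 'c) two_cat"
    and small :: "'a set"
    and pr lft :: "'a \<Rightarrow> 'a \<Rightarrow> 'a"
    and T :: "('o, 'a, 'c) two_monad"
  assumes "plumbus K small pr lft"
    and "enhanced_two_monad K T"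
  shows "\<exists>pr' lft'.
    plumbus (LaxAlg K T) {F. strict_morphism K T F \<and> und1 F \<in> small} pr' lft'"
proof -
  interpret plumbus K small pr lft by fact
  interpret enhanced_two_monad K T by fact
  let ?small = "{F. strict_morphism K T F \<and> und1 F \<in> small}"
  let ?sq = "\<lambda>G P RS. lax_square P G (fst RS) (snd RS) (pr (und1 G) (und1 P)) (lft (und1 G) (und1 P))"
  \<comment> \<open>The projections depend on each other through the algebra at their common source, so they are
    chosen as a pair.\<close>
  define choice where "choice G P = (THE RS. ?sq G P RS)" for G P
  define pr' where "pr' G P = fst (choice G P)" for G P
  define lft' where "lft' G P = snd (choice G P)" for G P
  have g: "und1 G \<in> hom1 K (carr (mor_src G)) (trg K (und1 P))"
    if "lax_morphism K T G" "strict_morphism K T P" "mor_trg G = mor_trg P" for G P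
    using that by (simp add: hom1_def)
  have unique: "pr' G P = R" "lft' G P = S"
    if P: "strict_morphism K T P" "und1 P \<in> small" and G: "lax_morphism K T G" "mor_trg G = mor_trg P"
      and sq: "lax_square P G R S (pr (und1 G) (und1 P)) (lft (und1 G) (und1 P))" for P G R S
  proof -
    note gg = g[OF G(1) P(1) G(2)]
    have "two_pullback K (und1 P) (und1 G) (pr (und1 G) (und1 P)) (lft (und1 G) (und1 P))"
      using chosen_pullback[OF P(2) gg] unfolding left_tight_pullback_def by blast
    note u = lax_square_unique[OF P(1) G small_dopf[OF P(2)] small_dopf[OF pr_small[OF P(2) gg]] this]
    have "choice G P = (R, S)"
      unfolding choice_def by (rule the_equality) (use sq u in \<open>auto simp: prod_eq_iff\<close>)
    then show "pr' G P = R" "lft' G P = S" unfolding pr'_def lft'_def by simp_all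
  qed
  have square: "lax_square P G (pr' G P) (lft' G P) (pr (und1 G) (und1 P)) (lft (und1 G) (und1 P))"
    if P: "strict_morphism K T P" "und1 P \<in> small" and G: "lax_morphism K T G" "mor_trg G = mor_trg P"
    for P G
  proof -
    note gg = g[OF G(1) P(1) G(2)]
    obtain R S where sq: "lax_square P G R S (pr (und1 G) (und1 P)) (lft (und1 G) (und1 P))"
      by (rule lax_square_exists[OF P(1) G small_dopf[OF P(2)] small_dopf[OF pr_small[OF P(2) gg]]
            chosen_pullback[OF P(2) gg]])
    then show ?thesis using unique[OF P G sq] by simp
  qed
  interpret L: enhanced_two_category "LaxAlg K T" by (rule enhanced_LaxAlg)
  have smallpr: "strict_morphism K T (pr' G P)" "und1 (pr' G P) \<in> small"
      "mor_trg (pr' G P) = mor_src G" "und1 (pr' G P) = pr (und1 G) (und1 P)"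
      "und1 (lft' G P) = lft (und1 G) (und1 P)"
    if "strict_morphism K T P" "und1 P \<in> small" "lax_morphism K T G" "mor_trg G = mor_trg P" for P G
    using square[OF that] pr_small[OF that(2) g[OF that(3,1,4)]] unfolding lax_square_def by auto
  have functorial: "pr' (comp_mor K T G H) P = pr' H (pr' G P)"
      "lft' (comp_mor K T G H) P = comp_mor K T (lft' G P) (lft' H (pr' G P))"
    if P: "strict_morphism K T P" "und1 P \<in> small"
      and G: "lax_morphism K T G" "mor_trg G = mor_trg P"
      and H: "lax_morphism K T H" "mor_trg H = mor_src G" for P G H
  proof -
    note gg = g[OF G(1) P(1) G(2)]
    note r = smallpr[OF P G]
    have h: "und1 H \<in> hom1 K (carr (mor_src H)) (carr (mor_src G))"
      using H by (simp add: hom1_def)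
    have "lax_square (pr' G P) H (pr' H (pr' G P)) (lft' H (pr' G P))
        (pr (und1 H) (und1 (pr' G P))) (lft (und1 H) (und1 (pr' G P)))"
      by (rule square) (use r H in simp_all)
    from lax_square_comp[OF P(1) G H square[OF P G] this]
    have sq: "lax_square P (comp_mor K T G H) (pr' H (pr' G P))
        (comp_mor K T (lft' G P) (lft' H (pr' G P)))
        (pr (und1 (comp_mor K T G H)) (und1 P)) (lft (und1 (comp_mor K T G H)) (und1 P))"
      using pr_comp1[OF P(2) gg h] lft_comp1[OF P(2) gg h] r(4) by simp
    have GH: "lax_morphism K T (comp_mor K T G H)" "mor_trg (comp_mor K T G H) = mor_trg P"
      using G H by simp_all
    show "pr' (comp_mor K T G H) P = pr' H (pr' G P)"
      "lft' (comp_mor K T G H) P = comp_mor K T (lft' G P) (lft' H (pr' G P))"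
      using unique[OF P GH sq] by simp_all
  qed
  have "plumbus (LaxAlg K T) ?small pr' lft'"
  proof (unfold_locales, goal_cases)
    case (1 P)
    then show ?case using dopf_LaxAlg small_dopf by auto
  next
    case (2 P G A)
    then show ?case using smallpr[of P G] by auto
  next
    case (3 P G A)
    then have P: "strict_morphism K T P" "und1 P \<in> small" "lax_morphism K T G" "mor_trg G = mor_trg P"
      by auto
    note gg = g[OF P(3,1,4)]
    show ?case
      by (rule left_tight_pullback_LaxAlg[OF P(1,3,4) small_dopf[OF P(2)]
            small_dopf[OF pr_small[OF P(2) gg]] chosen_pullback[OF P(2) gg] square[OF P]])
  next
    case (4 P)
    then have P: "strict_morphism K T P" "und1 P \<in> small" by auto
    then show ?case
      using unique(1)[of P "id_mor K (mor_trg P)" P "id_mor K (mor_src P)"] lax_square_id[OF P(1)]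
        pr_id1[OF P(2)] lft_id1[OF P(2)] by simp
  next
    case (5 P)
    then have P: "strict_morphism K T P" "und1 P \<in> small" by auto
    then show ?case
      using unique(2)[of P "id_mor K (mor_trg P)" P "id_mor K (mor_src P)"] lax_square_id[OF P(1)]
        pr_id1[OF P(2)] lft_id1[OF P(2)] by simp
  next
    case (6 P G A H A')
    then show ?case using functorial(1)[of P G H] by simp
  next
    case (7 P G A H A')
    then show ?case using functorial(2)[of P G H] by simp
  next
    case (8 F G)
    then show ?case using replete_LaxAlg[of F G] replete by blast
  next
    case 9
    then show ?case using tight_terminal tight_terminal_LaxAlg by blast
  qed
  then show ?thesis by blast
qed

end
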